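(* There exists a $3$-dimensional split abelian subgroup $H$ of $SL(5,\mathbb{R})$ satisfying the following two conditions: (1) There exists a discrete subgroup $\Gamma$ of $SL(5,\mathbb{R})$ such that $\Gamma$ is not virtually abelian and the $\Gamma$-action on the homogeneous space $SL(5,\mathbb{R})/H$ is properly discontinuous. (2) For any Lie group homomorphism $\Phi : SL(2,\mathbb{R}) \rightarrow SL(5,\mathbb{R})$, the action of $SL(2,\mathbb{R})$ on the homogeneous space $SL(5,\mathbb{R})/H$ via $\Phi$ is not proper.
   Context: A $3$-dimensional split abelian subgroup of $SL(5,\mathbb{R})$ means a subgroup of the form $\exp \mathfrak{h}$, where $\mathfrak{h} \subset \mathfrak{sl}(5,\mathbb{R})$ is a $3$-dimensional abelian subalgebra that is conjugate, under $SL(5,\mathbb{R})$, to a linear subspace of the space of real diagonal traceless $5 \times 5$ matrices; such a subgroup is closed and isomorphic to $\mathbb{R}^3$. A continuous action of a locally compact group $L$ on a locally compact topological space $X$ is called proper if $\{\, g \in L \mid gS \cap S \neq \emptyset \,\}$ is compact for every compact subset $S$ of $X$. A proper action of a discrete group $L$ (with the discrete topology) is called properly discontinuous; that is, the set $\{\, g \in L \mid gS \cap S \neq \emptyset \,\}$ is finite for every compact $S \subset X$. A subgroup $\Gamma \subset SL(5,\mathbb{R})$ acts on $SL(5,\mathbb{R})/H$ by left translations, and $SL(2,\mathbb{R})$ acts on $SL(5,\mathbb{R})/H$ via $\Phi$ by $g \cdot xH = \Phi(g)xH$. A group is virtually abelian if it has an abelian subgroup of finite index. *)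

theory Defs
  imports "HOL-Analysis.Analysis" "HOL-Algebra.Left_Coset"
begin

definition SL :: "(real^'n^'n) monoid" where
  "SL = \<lparr>carrier = {A. det A = 1}, mult = (**), one = mat 1\<rparr>"

abbreviation SL_top :: "(real^'n^'n) topology" where
  "SL_top \<equiv> top_of_set (carrier SL)"

lemma group_SL: "group (SL :: (real^'n^'n) monoid)"
proof (rule groupI)
  fix A :: "real^'n^'n"
  assume A: "A \<in> carrier SL"
  then have "invertible A"
    by (simp add: SL_def invertible_det_nz)
  then have inv: "matrix_inv A ** A = mat 1"
    unfolding invertible_def matrix_inv_def by (rule someI2_ex) blast
  moreover have "det (matrix_inv A) = 1"
    using A arg_cong[OF inv, of det] by (simp add: SL_def det_mul)
  ultimately show "\<exists>B\<in>carrier SL. B \<otimes>\<^bsub>SL\<^esub> A = \<one>\<^bsub>SL\<^esub>"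
    by (intro bexI[of _ "matrix_inv A"]) (simp_all add: SL_def)
qed (simp_all add: SL_def det_mul matrix_mul_assoc)

text \<open>On the type \<open>real^'n^'n\<close> the overloaded product \<open>*\<close> is componentwise, so the
  exponential series is written with the iterates of left multiplication \<open>A ** _\<close>,
  i.e. with the matrix powers of \<open>A\<close>.\<close>

definition matrix_exp :: "real^'n^'n \<Rightarrow> real^'n^'n" where
  "matrix_exp A = (\<Sum>k. (1 / fact k) *\<^sub>R (((\<lambda>B. A ** B) ^^ k) (mat 1)))"

definition abelian_subalgebra_sl :: "(real^'n^'n) set \<Rightarrow> bool" where
  "abelian_subalgebra_sl \<hh> \<longleftrightarrow>
     subspace \<hh> \<and> (\<forall>X\<in>\<hh>. trace X = 0) \<and> (\<forall>X\<in>\<hh>. \<forall>Y\<in>\<hh>. X ** Y - Y ** X = 0)"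

definition traceless_diagonal :: "(real^'n^'n) set" where
  "traceless_diagonal = {D. trace D = 0 \<and> (\<forall>i j. i \<noteq> j \<longrightarrow> D $ i $ j = 0)}"

definition split_abelian_subgroup :: "nat \<Rightarrow> (real^'n^'n) set \<Rightarrow> bool" where
  "split_abelian_subgroup d H \<longleftrightarrow> subgroup H SL \<and>
     (\<exists>\<hh>. abelian_subalgebra_sl \<hh> \<and> dim \<hh> = d \<and>
        (\<exists>g\<in>carrier SL. \<exists>V. subspace V \<and> V \<subseteq> traceless_diagonal \<and>
            (\<lambda>X. g ** X ** matrix_inv g) ` \<hh> = V) \<and>
        H = matrix_exp ` \<hh>)"

text \<open>The homogeneous space \<open>SL/H\<close>: the set of left cosets with the quotient topology.\<close>

definition homogeneous_space :: "(real^'n^'n) set \<Rightarrow> (real^'n^'n) set topology" where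
  "homogeneous_space H = topology (\<lambda>U. U \<subseteq> lcosets\<^bsub>SL\<^esub> H \<and>
     openin SL_top {x \<in> carrier SL. x <#\<^bsub>SL\<^esub> H \<in> U})"

lemma openin_homogeneous_space:
  "openin (homogeneous_space H) U \<longleftrightarrow> U \<subseteq> lcosets\<^bsub>SL\<^esub> H \<and>
     openin SL_top {x \<in> carrier SL. x <#\<^bsub>SL\<^esub> H \<in> U}"
proof -
  have "istopology (\<lambda>U. U \<subseteq> lcosets\<^bsub>SL\<^esub> H \<and>
     openin SL_top {x \<in> carrier SL. x <#\<^bsub>SL\<^esub> H \<in> U})"
    unfolding istopology_def
  proof (intro conjI allI impI)
    fix S T
    assume S: "S \<subseteq> lcosets\<^bsub>SL\<^esub> H \<and> openin SL_top {x \<in> carrier SL. x <#\<^bsub>SL\<^esub> H \<in> S}"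
      and T: "T \<subseteq> lcosets\<^bsub>SL\<^esub> H \<and> openin SL_top {x \<in> carrier SL. x <#\<^bsub>SL\<^esub> H \<in> T}"
    have "{x \<in> carrier SL. x <#\<^bsub>SL\<^esub> H \<in> S \<inter> T} =
        {x \<in> carrier SL. x <#\<^bsub>SL\<^esub> H \<in> S} \<inter> {x \<in> carrier SL. x <#\<^bsub>SL\<^esub> H \<in> T}"
      by auto
    then show "openin SL_top {x \<in> carrier SL. x <#\<^bsub>SL\<^esub> H \<in> S \<inter> T}"
      using S T by (simp only: openin_Int)
    show "S \<inter> T \<subseteq> lcosets\<^bsub>SL\<^esub> H"
      using S by auto
  next
    fix K
    assume K: "\<forall>S\<in>K. S \<subseteq> lcosets\<^bsub>SL\<^esub> H \<and> openin SL_top {x \<in> carrier SL. x <#\<^bsub>SL\<^esub> H \<in> S}"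
    have "{x \<in> carrier SL. x <#\<^bsub>SL\<^esub> H \<in> \<Union>K} =
        (\<Union>S\<in>K. {x \<in> carrier SL. x <#\<^bsub>SL\<^esub> H \<in> S})"
      by auto
    then show "openin SL_top {x \<in> carrier SL. x <#\<^bsub>SL\<^esub> H \<in> \<Union>K}"
      using K by (metis (no_types, lifting) openin_Union imageE)
    show "\<Union>K \<subseteq> lcosets\<^bsub>SL\<^esub> H"
      using K by auto
  qed
  then show ?thesis
    by (simp add: homogeneous_space_def topology_inverse')
qed

lemma topspace_homogeneous_space: "topspace (homogeneous_space H) = lcosets\<^bsub>SL\<^esub> H"
proof (rule antisym)
  have "{x \<in> carrier SL. x <#\<^bsub>SL\<^esub> H \<in> lcosets\<^bsub>SL\<^esub> H} = carrier SL"
    by (auto simp: LCOSETS_def)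
  then have "openin (homogeneous_space H) (lcosets\<^bsub>SL\<^esub> H)"
    by (simp add: openin_homogeneous_space)
  then show "lcosets\<^bsub>SL\<^esub> H \<subseteq> topspace (homogeneous_space H)"
    by (rule openin_subset)
  show "topspace (homogeneous_space H) \<subseteq> lcosets\<^bsub>SL\<^esub> H"
    using openin_topspace[of "homogeneous_space H"] unfolding openin_homogeneous_space by blast
qed

text \<open>Left translation of cosets: for a coset \<open>C = xH\<close> the set \<open>gC\<close> is the coset \<open>(gx)H\<close>.\<close>

abbreviation translate :: "real^'n^'n \<Rightarrow> (real^'n^'n) set \<Rightarrow> (real^'n^'n) set" where
  "translate g C \<equiv> g <#\<^bsub>SL\<^esub> C"

lemma translate_coset:
  assumes "g \<in> carrier SL" "x \<in> carrier SL" "H \<subseteq> carrier SL"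
  shows "translate g (x <#\<^bsub>SL\<^esub> H) = (g \<otimes>\<^bsub>SL\<^esub> x) <#\<^bsub>SL\<^esub> H"
  using assms by (simp add: group.lcos_m_assoc[OF group_SL])

text \<open>Properness of a continuous action \<open>act\<close> of a topological group with underlying space
  \<open>L\<close> on the space \<open>X\<close>.\<close>

definition proper_action :: "'l topology \<Rightarrow> 'x topology \<Rightarrow> ('l \<Rightarrow> 'x \<Rightarrow> 'x) \<Rightarrow> bool" where
  "proper_action L X act \<longleftrightarrow>
     (\<forall>S. compactin X S \<longrightarrow> compactin L {g \<in> topspace L. act g ` S \<inter> S \<noteq> {}})"

definition properly_discontinuous_action :: "'l set \<Rightarrow> 'x topology \<Rightarrow> ('l \<Rightarrow> 'x \<Rightarrow> 'x) \<Rightarrow> bool"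
  where "properly_discontinuous_action \<Gamma> X act \<longleftrightarrow> proper_action (discrete_topology \<Gamma>) X act"

lemma properly_discontinuous_action_iff:
  "properly_discontinuous_action \<Gamma> X act \<longleftrightarrow>
     (\<forall>S. compactin X S \<longrightarrow> finite {g \<in> \<Gamma>. act g ` S \<inter> S \<noteq> {}})"
  by (auto simp: properly_discontinuous_action_def proper_action_def compactin_discrete_topology)

definition discrete_subgroup_SL :: "(real^'n^'n) set \<Rightarrow> bool" where
  "discrete_subgroup_SL \<Gamma> \<longleftrightarrow> subgroup \<Gamma> SL \<and> discrete \<Gamma>"

definition virtually_abelian :: "('a, 'b) monoid_scheme \<Rightarrow> bool" where
  "virtually_abelian G \<longleftrightarrow>
     (\<exists>A. subgroup A G \<and> comm_group (G\<lparr>carrier := A\<rparr>) \<and> finite (rcosets\<^bsub>G\<^esub> A))"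

text \<open>\<open>C_k k f U\<close>: \<open>f\<close> is of class \<open>C^k\<close> on the open set \<open>U\<close>, via iterated directional
  derivatives.\<close>

primrec C_k :: "nat \<Rightarrow> ('a::euclidean_space \<Rightarrow> 'b::euclidean_space) \<Rightarrow> 'a set \<Rightarrow> bool" where
  "C_k 0 f U \<longleftrightarrow> continuous_on U f"
| "C_k (Suc k) f U \<longleftrightarrow> f differentiable_on U \<and>
     (\<forall>v. C_k k (\<lambda>x. frechet_derivative f (at x) v) U)"

text \<open>Smoothness on a subset \<open>S\<close> of a Euclidean space: locally the restriction of a
  \<open>C^\<infinity>\<close> map defined on an open set. As \<open>SL\<close> is an embedded submanifold of the space of
  matrices, this is the usual smoothness of maps between the Lie groups \<open>SL\<close>.\<close>

definition smooth_map_on :: "'a set \<Rightarrow> ('a::euclidean_space \<Rightarrow> 'b::euclidean_space) \<Rightarrow> bool" where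
  "smooth_map_on S f \<longleftrightarrow>
     (\<forall>x\<in>S. \<exists>U F. open U \<and> x \<in> U \<and> (\<forall>k. C_k k F U) \<and> (\<forall>y\<in>S \<inter> U. F y = f y))"

definition lie_group_hom_SL :: "(real^'m^'m \<Rightarrow> real^'n^'n) \<Rightarrow> bool" where
  "lie_group_hom_SL \<Phi> \<longleftrightarrow> \<Phi> \<in> hom SL SL \<and> smooth_map_on (carrier SL) \<Phi>"

end

theory Submission
  imports Defs
begin

text \<open>Let \<open>H = exp \<hh>\<close>, where \<open>\<hh>\<close> is the space of traceless diagonal matrices \<open>diag(x\<^sub>1,\<dots>,x\<^sub>5)\<close>
killed by the linear form \<open>\<xi> = (0,0,1,2,3)\<close>. Whether a group acts properly on \<open>SL(5,\<real>)/H\<close> is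
decided, in the spirit of the criterion of Benoist and Kobayashi, by the logarithms of the singular
values of its elements: they have to move away from all coordinate permutations of \<open>\<hh>\<close>. A vector
\<open>(a,b,0,-b,-a)\<close> with \<open>a \<ge> b \<ge> 0\<close>, not zero, has a permutation in \<open>\<hh>\<close> iff
\<open>a(\<xi>\<^sub>i - \<xi>\<^sub>j) + b(\<xi>\<^sub>k - \<xi>\<^sub>l) = 0\<close> for some distinct \<open>i,j,k,l\<close>, that is, iff \<open>a/b\<close> is one of
\<open>1, 3/2, 2, 3, \<infinity>\<close>. The form \<open>\<xi>\<close> is chosen so that these ratios include all the ones that
representations of \<open>SL(2,\<real>)\<close> can produce, but leave the interval \<open>a/b > 3\<close> free.

For a homomorphism \<open>\<Phi>\<close> from \<open>SL(2,\<real>)\<close>, the derivative at the identity is a representation of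
\<open>sl\<^sub>2\<close> on \<open>\<real>\<^sup>5\<close>. Its diagonal element acts diagonalizably with integer weights
(\<open>span_weight_vectors\<close>). The weights are symmetric and decrease in multiplicity in steps of two,
so they form \<open>(a,b,0,-b,-a)\<close> with \<open>(a,b)\<close> among \<open>(0,0), (1,0), (2,0), (1,1), (2,1), (3,1), (4,2)\<close>;
in each case some ordering lies in \<open>\<hh>\<close> (\<open>sl2_weight_multisets_of_size_5\<close>). Hence all of
\<open>\<Phi>(diag(exp t, exp (-t)))\<close> is conjugated into \<open>H\<close> by one matrix \<open>g\<inverse>\<close>, so an unbounded group fixes
the point \<open>gH\<close> and the action is not proper (\<open>SL2_action_not_proper\<close>).

For the discrete group, take two pairs of hyperbolic matrices in \<open>SL(2,\<real>)\<close> with the same axes, one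
pair with eigenvalue 10000 and the other with eigenvalue 10, and put them into diagonal blocks.
By ping-pong (\<open>max_entry_reduced_word_ge\<close>) the logarithms of the singular values of a reduced word of
length \<open>n\<close> are \<open>(a,b,0,-b,-a)\<close> in some order, where both \<open>b\<close> and \<open>a - 3b\<close> grow linearly in \<open>n\<close>. Such vectors
leave every bounded neighbourhood of the permutations of \<open>\<hh>\<close> (\<open>root_form_avoids_log_H\<close>).
In place of singular values, the proof works with pivots: a pivoted triangular decomposition
(\<open>pivot_decomposition\<close>) gives diagonal factors of the words, and the Leibniz formula for the
determinant compares these with the elements of \<open>H\<close> up to a permutation and a bounded error
(\<open>diagonal_comparison\<close>). So only finitely many elements of the group can move a compact subset
of \<open>SL(5,\<real>)/H\<close> onto one that meets it.\<close>

section \<open>Finite-dimensional representations of sl2\<close>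

text \<open>The usual argument that an invariant subspace is graded: applying \<open>h - a\<close> removes the component of
weight \<open>a\<close> and multiplies the others by non-zero scalars.\<close>

lemma weight_components_mem:
  fixes h :: "'a::real_vector \<Rightarrow> 'a"
  assumes h: "linear h" and U: "subspace U" and inv: "\<And>v. v \<in> U \<Longrightarrow> h v \<in> U"
    and fin: "finite A"
  shows "(\<And>x. x \<in> A \<Longrightarrow> h (y x) = x *\<^sub>R y x) \<Longrightarrow> (\<Sum>x\<in>A. y x) \<in> U \<Longrightarrow> \<forall>x\<in>A. y x \<in> U"
  using fin
proof (induction A arbitrary: y rule: finite_induct)
  case empty
  then show ?case by simp
next
  case (insert a A)
  let ?s = "\<Sum>x\<in>insert a A. y x"
  have hs: "h ?s = (\<Sum>x\<in>insert a A. x *\<^sub>R y x)"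
    by (simp only: linear_sum[OF h] o_def) (intro sum.cong refl insert.prems(1))
  have "h ?s - a *\<^sub>R ?s = (\<Sum>x\<in>insert a A. (x - a) *\<^sub>R y x)"
    unfolding hs by (simp only: scaleR_sum_right sum_subtractf[symmetric] scaleR_diff_left)
  also have "\<dots> = (\<Sum>x\<in>A. (x - a) *\<^sub>R y x)"
    using insert.hyps by simp
  finally have "(\<Sum>x\<in>A. (x - a) *\<^sub>R y x) = h ?s - a *\<^sub>R ?s" by simp
  moreover have "h ?s - a *\<^sub>R ?s \<in> U"
    using insert.prems(2) inv U by (simp only: subspace_diff subspace_scale)
  ultimately have "\<forall>x\<in>A. (x - a) *\<^sub>R y x \<in> U"
    using insert.IH[of "\<lambda>x. (x - a) *\<^sub>R y x"] insert.prems(1)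
    by (auto simp: linear_scale[OF h] mult.commute)
  then have A: "y x \<in> U" if "x \<in> A" for x
  proof -
    have "x - a \<noteq> 0" using that insert.hyps by auto
    have "(1 / (x - a)) *\<^sub>R ((x - a) *\<^sub>R y x) \<in> U"
      using that \<open>\<forall>x\<in>A. (x - a) *\<^sub>R y x \<in> U\<close> U by (metis subspace_scale)
    then show ?thesis using \<open>x - a \<noteq> 0\<close> by simp
  qed
  have "?s - (\<Sum>x\<in>A. y x) \<in> U"
    by (intro subspace_diff[OF U] insert.prems(2) subspace_sum[OF U] A)
  moreover have "?s - (\<Sum>x\<in>A. y x) = y a"
    using insert.hyps by simp
  ultimately have "y a \<in> U" by simp
  then show ?case using A by auto
qed

locale sl2_triple =
  fixes e f h :: "'a::euclidean_space \<Rightarrow> 'a"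
  assumes lin_e: "linear e" and lin_f: "linear f" and lin_h: "linear h"
    and ef: "e (f v) = f (e v) + h v"
    and he: "h (e v) = e (h v) + 2 *\<^sub>R e v"
    and hf: "h (f v) = f (h v) - 2 *\<^sub>R f v"
begin

lemmas lin_simps =
  linear_add[OF lin_e] linear_add[OF lin_f] linear_add[OF lin_h]
  linear_diff[OF lin_e] linear_diff[OF lin_f] linear_diff[OF lin_h]
  linear_scale[OF lin_e] linear_scale[OF lin_f] linear_scale[OF lin_h]
  linear_0[OF lin_e] linear_0[OF lin_f] linear_0[OF lin_h]

lemma linear_e_pow: "linear (e ^^ k)"
proof (induction k)
  case 0
  show ?case by (simp only: funpow.simps linear_id)
next
  case (Suc k)
  show ?case unfolding funpow.simps by (rule linear_compose[OF Suc.IH lin_e])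
qed

lemma linear_f_pow: "linear (f ^^ k)"
proof (induction k)
  case 0
  show ?case by (simp only: funpow.simps linear_id)
next
  case (Suc k)
  show ?case unfolding funpow.simps by (rule linear_compose[OF Suc.IH lin_f])
qed

lemma h_e_pow: "h ((e ^^ k) v) = (e ^^ k) (h v) + (2 * real k) *\<^sub>R (e ^^ k) v"
  by (induction k) (simp_all add: he lin_simps scaleR_left_distrib scaleR_right_distrib)

text \<open>The power \<open>e^k\<close> is an eigenvector of the bounded operator \<open>ad h\<close> with eigenvalue \<open>2k\<close>. An eigenvalue
cannot exceed the operator norm, so \<open>e^k\<close> vanishes as soon as \<open>k\<close> exceeds the norm of \<open>h\<close>.\<close>

lemma e_nilpotent: "\<exists>k. \<forall>v. (e ^^ k) v = 0"
proof -
  obtain C where C: "\<And>v. norm (h v) \<le> C * norm v"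
    using linear_bounded[OF lin_h] by blast
  obtain k :: nat where k: "real k > C"
    using reals_Archimedean2 by blast
  have C0: "C \<ge> 0"
    using C[of "SOME i. i \<in> Basis"] norm_ge_zero order_trans
    by (metis SOME_Basis mult.right_neutral norm_Basis)
  define s where "s = onorm (e ^^ k)"
  have bl: "bounded_linear (e ^^ k)"
    using linear_e_pow linear_conv_bounded_linear by blast
  have "2 * real k * norm ((e ^^ k) v) \<le> 2 * C * s * norm v" for v
  proof -
    have "(2 * real k) * norm ((e ^^ k) v) = norm (h ((e ^^ k) v) - (e ^^ k) (h v))"
      by (simp add: h_e_pow)
    also have "\<dots> \<le> norm (h ((e ^^ k) v)) + norm ((e ^^ k) (h v))"
      by (rule norm_triangle_ineq4)
    also have "\<dots> \<le> C * (s * norm v) + s * (C * norm v)"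
      unfolding s_def
      by (intro add_mono order_trans[OF C] mult_left_mono order_trans[OF onorm[OF bl]] onorm bl C0 C
          onorm_pos_le)
    finally show ?thesis by (simp add: algebra_simps)
  qed
  then have "norm ((e ^^ k) v) \<le> (C * s / real k) * norm v" for v
    using k C0 by (simp add: field_simps)
  then have "s \<le> C * s / real k"
    unfolding s_def by (intro onorm_bound) (use C0 bl in \<open>auto simp: onorm_pos_le\<close>)
  then have "s * (real k - C) \<le> 0"
    using k C0 by (simp add: field_simps)
  then have "s \<le> 0"
    using k by (simp add: mult_le_0_iff)
  have "(e ^^ k) v = 0" for v
  proof -
    have "norm ((e ^^ k) v) \<le> s * norm v"
      unfolding s_def by (rule onorm[OF bl])
    also have "\<dots> \<le> 0"
      using \<open>s \<le> 0\<close> by (simp add: mult_nonpos_nonneg)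
    finally show ?thesis by simp
  qed
  then show ?thesis by blast
qed

text \<open>This symmetry transfers each statement about \<open>e\<close> to \<open>f\<close>.\<close>

lemma swapped_triple: "sl2_triple f e (\<lambda>v. - h v)"
  by (rule sl2_triple.intro)
     (simp_all add: lin_e lin_f ef he hf linear_neg[OF lin_e] linear_neg[OF lin_f] lin_h linear_compose_neg)

lemma f_nilpotent: "\<exists>k. \<forall>v. (f ^^ k) v = 0"
  using sl2_triple.e_nilpotent[OF swapped_triple] .

lemma e_f_pow:
  "e ((f ^^ Suc k) v) = (f ^^ Suc k) (e v) + real (Suc k) *\<^sub>R (f ^^ k) (h v - real k *\<^sub>R v)"
proof (induction k)
  case 0
  then show ?case by (simp add: ef)
next
  case (Suc k)
  have fh: "h ((f ^^ m) v) = (f ^^ m) (h v) - (2 * real m) *\<^sub>R (f ^^ m) v" for m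
    using sl2_triple.h_e_pow[OF swapped_triple, of m v]
    by (simp add: linear_neg[OF linear_f_pow] algebra_simps)
  have "e ((f ^^ Suc (Suc k)) v) = f (e ((f ^^ Suc k) v)) + h ((f ^^ Suc k) v)"
    by (simp add: ef)
  also have "\<dots> = (f ^^ Suc (Suc k)) (e v)
      + (real (Suc k) *\<^sub>R (f ^^ Suc k) (h v - real k *\<^sub>R v)
         + (f ^^ Suc k) (h v) - (2 * real (Suc k)) *\<^sub>R (f ^^ Suc k) v)"
    unfolding Suc.IH fh by (simp add: lin_simps del: of_nat_Suc)
  also have "(real (Suc k) *\<^sub>R (f ^^ Suc k) (h v - real k *\<^sub>R v)
         + (f ^^ Suc k) (h v) - (2 * real (Suc k)) *\<^sub>R (f ^^ Suc k) v) =
      real (Suc (Suc k)) *\<^sub>R (f ^^ Suc k) (h v - real (Suc k) *\<^sub>R v)"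
    unfolding linear_diff[OF linear_f_pow] linear_scale[OF linear_f_pow]
    by (simp only: of_nat_Suc) (simp add: algebra_simps scaleR_2)
  finally show ?case .
qed

definition weight_space :: "real \<Rightarrow> 'a set" where
  "weight_space x = {v. h v = x *\<^sub>R v}"

lemma subspace_weight_space: "subspace (weight_space x)"
  unfolding weight_space_def subspace_def by (simp add: lin_simps scaleR_right_distrib)

lemma e_weight: "v \<in> weight_space x \<Longrightarrow> e v \<in> weight_space (x + 2)"
  by (simp add: weight_space_def he lin_simps scaleR_left_distrib)

lemma f_weight: "v \<in> weight_space x \<Longrightarrow> f v \<in> weight_space (x - 2)"
  by (simp add: weight_space_def hf lin_simps scaleR_left_diff_distrib)

lemma ker_e_invariant: "e v = 0 \<Longrightarrow> e (h v) = 0"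
  using he[of v] by (simp add: lin_simps)

text \<open>The falling factorial \<open>h (h - 1) \<cdots> (h - k + 1)\<close>, which arises when \<open>e^k f^k\<close> is evaluated on
vectors killed by \<open>e\<close>.\<close>

primrec h_factorial :: "nat \<Rightarrow> 'a \<Rightarrow> 'a" where
  "h_factorial 0 v = v"
| "h_factorial (Suc k) v = h_factorial k (h v - real k *\<^sub>R v)"

lemma e_pow_f_pow_on_ker_e:
  "e v = 0 \<Longrightarrow> (e ^^ k) ((f ^^ k) v) = fact k *\<^sub>R h_factorial k v"
proof (induction k arbitrary: v)
  case 0
  then show ?case by simp
next
  case (Suc k)
  let ?u = "h v - real k *\<^sub>R v"
  have u: "e ?u = 0"
    using Suc.prems ker_e_invariant by (simp add: lin_simps)
  have "(e ^^ Suc k) ((f ^^ Suc k) v) = (e ^^ k) (e ((f ^^ Suc k) v))"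
    by (simp add: funpow_swap1)
  also have "\<dots> = (e ^^ k) (real (Suc k) *\<^sub>R (f ^^ k) ?u)"
    unfolding e_f_pow Suc.prems linear_0[OF linear_f_pow] by simp
  also have "\<dots> = real (Suc k) *\<^sub>R (fact k *\<^sub>R h_factorial k ?u)"
    by (simp only: linear_scale[OF linear_e_pow] Suc.IH[OF u])
  finally show ?case by simp
qed

lemma h_factorial_eq_0_decomposition:
  "h_factorial k v = 0 \<Longrightarrow> \<exists>y. (\<forall>j<k. y j \<in> weight_space (real j)) \<and> v = (\<Sum>j<k. y j)"
proof (induction k arbitrary: v)
  case 0
  then show ?case by simp
next
  case (Suc k)
  then obtain y where y: "\<And>j. j < k \<Longrightarrow> y j \<in> weight_space (real j)"
    and s: "h v - real k *\<^sub>R v = (\<Sum>j<k. y j)"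
    by auto
  define z where "z j = (1 / (real j - real k)) *\<^sub>R y j" for j
  have z: "h (z j) - real k *\<^sub>R z j = y j" if "j < k" for j
  proof -
    have "h (z j) = real j *\<^sub>R z j"
      using y[OF that] by (simp add: z_def weight_space_def lin_simps)
    then have "h (z j) - real k *\<^sub>R z j = (real j - real k) *\<^sub>R z j"
      by (simp only: scaleR_left_diff_distrib)
    then show ?thesis using that by (simp add: z_def)
  qed
  define w where "w = v - (\<Sum>j<k. z j)"
  have "h w - real k *\<^sub>R w = (h v - real k *\<^sub>R v) - (\<Sum>j<k. h (z j) - real k *\<^sub>R z j)"
    by (simp add: w_def lin_simps linear_sum[OF lin_h] scaleR_sum_right sum_subtractf algebra_simps)
  also have "\<dots> = 0"
    unfolding s by (simp add: z)
  finally have w: "w \<in> weight_space (real k)"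
    by (simp add: weight_space_def)
  have "z j \<in> weight_space (real j)" if "j < k" for j
    using y[OF that] subspace_scale[OF subspace_weight_space] by (simp add: z_def)
  then show ?case
    using w by (intro exI[of _ "\<lambda>j. if j = k then w else z j"]) (auto simp: w_def less_Suc_eq)
qed

text \<open>As \<open>f\<close> is nilpotent, \<open>e^k f^k = 0\<close> for large \<open>k\<close>, and on the kernel of \<open>e\<close> this says that \<open>h\<close> is
annihilated by the polynomial \<open>x (x - 1) \<cdots> (x - k + 1)\<close>, which has simple roots.\<close>

lemma ker_e_decomposition:
  assumes "e v = 0"
  shows "\<exists>(k::nat) y. (\<forall>j<k. y j \<in> weight_space (real j) \<and> e (y j) = 0) \<and> v = (\<Sum>j<k. y j)"
proof -
  obtain k where k: "\<And>v. (f ^^ k) v = 0"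
    using f_nilpotent by blast
  have "fact k *\<^sub>R h_factorial k v = 0"
    using e_pow_f_pow_on_ker_e[OF assms, of k] by (simp add: k linear_0[OF linear_e_pow])
  then obtain y where y: "\<forall>j<k. y j \<in> weight_space (real j)" "v = (\<Sum>j<k. y j)"
    using h_factorial_eq_0_decomposition[of k v] by auto
  let ?U = "{v. e v = 0}"
  have "(\<Sum>x\<in>real ` {..<k}. y (nat \<lfloor>x\<rfloor>)) = v"
    by (subst sum.reindex) (auto simp: y(2))
  then have "\<forall>x\<in>real ` {..<k}. y (nat \<lfloor>x\<rfloor>) \<in> ?U"
    using y(1) assms
    by (intro weight_components_mem[OF lin_h])
       (auto simp: weight_space_def ker_e_invariant lin_simps intro!: subspaceI)
  then show ?thesis
    using y by (intro exI[of _ k] exI[of _ y]) auto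
qed

text \<open>The Casimir operator \<open>4fe + h\<^sup>2 + 2h\<close> commutes with \<open>e\<close>. On \<open>y\<close> it takes the value \<open>x\<^sup>2 - 2x\<close>. The last
non-zero vector \<open>e^m y\<close> has some weight \<open>w \<ge> x\<close> and is killed by \<open>e\<close>, so there the value is
\<open>w\<^sup>2 + 2w\<close>, which is larger.\<close>

lemma e_f_injective:
  assumes y: "y \<in> weight_space x" and x: "x > 0" and ef0: "e (f y) = 0"
  shows "y = 0"
proof (rule ccontr)
  assume "y \<noteq> 0"
  obtain k where "\<And>v. (e ^^ k) v = 0"
    using e_nilpotent by blast
  then have "\<exists>m. (e ^^ m) y \<noteq> 0 \<and> (e ^^ Suc m) y = 0"
    using \<open>y \<noteq> 0\<close> nat_induct[of "\<lambda>m. (e ^^ m) y \<noteq> 0" k] by auto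
  then obtain m where m: "(e ^^ m) y \<noteq> 0" "(e ^^ Suc m) y = 0"
    by blast
  define casimir where "casimir v = 4 *\<^sub>R f (e v) + h (h v) + 2 *\<^sub>R h v" for v
  have comm: "casimir (e v) = e (casimir v)" for v
    using he[of v] he[of "h v"] ef[of "e v"] 
    by (simp add: casimir_def lin_simps scaleR_right_distrib)
       (simp add: algebra_simps flip: scaleR_left.add)
  have comm': "casimir ((e ^^ j) v) = (e ^^ j) (casimir v)" for j v
    by (induction j) (auto simp: comm)
  have hy: "h y = x *\<^sub>R y" using y by (simp add: weight_space_def)
  have "casimir y = 4 *\<^sub>R e (f y) + h (h y) - 2 *\<^sub>R h y"
    unfolding casimir_def ef by (simp add: algebra_simps flip: scaleR_left.add)
  then have "casimir y = (x * x - 2 * x) *\<^sub>R y"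
    by (simp add: ef0 hy lin_simps algebra_simps)
  then have 1: "casimir ((e ^^ m) y) = (x * x - 2 * x) *\<^sub>R (e ^^ m) y"
    by (simp add: comm' linear_scale[OF linear_e_pow])
  define w where "w = x + 2 * real m"
  have "h ((e ^^ m) y) = w *\<^sub>R (e ^^ m) y"
    by (simp add: w_def h_e_pow hy linear_scale[OF linear_e_pow] algebra_simps)
  then have "casimir ((e ^^ m) y) = (w * w + 2 * w) *\<^sub>R (e ^^ m) y"
    using m(2) by (simp add: casimir_def lin_simps scaleR_left_distrib)
  with 1 have "x * x - 2 * x = w * w + 2 * w"
    using m(1) by (metis scaleR_cancel_right)
  moreover have "w * w \<ge> x * x"
    using x unfolding w_def by (intro mult_mono) auto
  ultimately show False using x by (simp add: w_def)
qed

lemma f_injective: "y \<in> weight_space x \<Longrightarrow> x > 0 \<Longrightarrow> f y = 0 \<Longrightarrow> y = 0"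
  using e_f_injective by (simp add: lin_simps)

text \<open>On a finite-dimensional weight space of positive weight, the injective endomorphism \<open>e f\<close> is onto.\<close>

lemma e_surjective:
  assumes y: "y \<in> weight_space x" and x: "x > 0"
  shows "\<exists>z\<in>weight_space (x - 2). e z = y"
proof -
  let ?T = "\<lambda>v. e (f v)"
  have T: "linear ?T"
    using linear_compose[OF lin_f lin_e] by (simp add: o_def)
  have "inj_on ?T (weight_space x)"
  proof (rule inj_onI)
    fix u v assume *: "u \<in> weight_space x" "v \<in> weight_space x" "?T u = ?T v"
    have "u - v \<in> weight_space x"
      using * subspace_weight_space by (intro subspace_diff)
    then show "u = v"
      using e_f_injective[of "u - v" x] *(3) x by (simp add: lin_simps)
  qed
  then have "dim (?T ` weight_space x) = dim (weight_space x)"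
    using T subspace_weight_space by (intro dim_image_eq) (auto simp: span_eq_iff[THEN iffD2])
  moreover have "?T ` weight_space x \<subseteq> weight_space x"
    using e_weight[OF f_weight] by fastforce
  ultimately have "?T ` weight_space x = weight_space x"
    using T subspace_weight_space by (intro subspace_dim_equal linear_subspace_image) auto
  then show ?thesis
    using y f_weight by (metis imageE)
qed

definition weight_vectors :: "'a set" where
  "weight_vectors = (\<Union>w::int. weight_space (of_int w))"

lemma weight_vectors_span_decomposition:
  assumes "v \<in> span weight_vectors"
  shows "\<exists>A y. finite A \<and> (\<forall>w\<in>A. y w \<in> weight_space (of_int w)) \<and> v = (\<Sum>w\<in>A. y w)"
  using assms
proof (induction rule: span_induct_alt)
  case base
  show ?case by (rule exI[of _ "{}"]) simp
next
  case (step c b v)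
  then obtain A y w where A: "finite A" "\<forall>w\<in>A. y w \<in> weight_space (of_int w)" "v = (\<Sum>w\<in>A. y w)"
    and w: "b \<in> weight_space (of_int w)"
    by (auto simp: weight_vectors_def)
  define y' where "y' x = (if x \<in> A then y x else 0) + (if x = w then c *\<^sub>R b else 0)" for x
  have "y' x \<in> weight_space (of_int x)" for x
    using A(2) w subspace_weight_space unfolding y'_def
    by (auto intro!: subspace_add subspace_scale simp: subspace_0)
  moreover have "(\<Sum>x\<in>insert w A. y' x) = c *\<^sub>R b + v"
    using A(1) unfolding y'_def sum.distrib A(3)
    by (simp add: sum.If_cases Int_absorb1 subset_insertI)
  ultimately show ?case
    using A(1) by (intro exI[of _ "insert w A"] exI[of _ y']) auto
qed

text \<open>This is the part of complete reducibility that concerns \<open>h\<close>. By induction on \<open>k\<close>, the kernel of \<open>e^k\<close> is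
spanned by weight vectors: for \<open>v\<close> in the kernel of \<open>e^(k+1)\<close>, each weight component of \<open>e v\<close> lies in
the range of \<open>e\<close> and has a preimage that is a combination of weight vectors, so \<open>v\<close> differs from
such a combination by an element of the kernel of \<open>e\<close>. Positive weights are lifted by
\<open>e_surjective\<close>. If \<open>y = e v\<close> has weight \<open>w \<le> 0\<close>, then \<open>(h - (w - 2)) v\<close> lies in the kernel of \<open>e\<close>,
where the weights are non-negative and \<open>h - (w - 2)\<close> is therefore invertible; correcting \<open>v\<close> by an
element of that kernel makes it a vector of weight \<open>w - 2\<close>.\<close>

lemma span_weight_vectors: "span weight_vectors = UNIV"
proof -
  have base: "v \<in> span weight_vectors" if "e v = 0" for v
  proof -
    obtain k y where "\<forall>j<k. y j \<in> weight_space (real j) \<and> e (y j) = 0" "v = (\<Sum>j<k. y j)"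
      using ker_e_decomposition[of v] \<open>e v = 0\<close> by blast
    moreover have "weight_space (real j) \<subseteq> weight_vectors" for j
      unfolding weight_vectors_def by (metis UN_upper UNIV_I of_int_of_nat_eq)
    ultimately show ?thesis
      by (auto intro!: span_sum intro: span_base)
  qed
  have lift: "\<exists>z\<in>span weight_vectors. e z = y"
    if y: "y \<in> weight_space (of_int w)" "y = e v" for y v w
  proof (cases "w > 0")
    case True
    then obtain z where "z \<in> weight_space (of_int w - 2)" "e z = y"
      using e_surjective[OF y(1)] by auto
    moreover have "of_int w - 2 = (of_int (w - 2) :: real)" by simp
    ultimately show ?thesis
      unfolding weight_vectors_def by (metis UN_I UNIV_I span_base)
  next
    case False
    let ?c = "of_int w - 2 :: real"
    have "e (h v - ?c *\<^sub>R v) = h (e v) - of_int w *\<^sub>R e v"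
      by (simp add: he lin_simps algebra_simps)
    also have "\<dots> = 0"
      using y by (simp add: weight_space_def)
    finally obtain k u where u: "\<And>j. j < k \<Longrightarrow> u j \<in> weight_space (real j) \<and> e (u j) = 0"
      and s: "h v - ?c *\<^sub>R v = (\<Sum>j<k. u j)"
      using ker_e_decomposition[of "h v - ?c *\<^sub>R v"] by blast
    define z where "z = (\<Sum>j<k. (1 / (real j - ?c)) *\<^sub>R u j)"
    have "h z - ?c *\<^sub>R z = (\<Sum>j<k. (1 / (real j - ?c)) *\<^sub>R (h (u j) - ?c *\<^sub>R u j))"
      by (simp add: z_def linear_sum[OF lin_h] lin_simps scaleR_sum_right sum_subtractf
          scaleR_right_diff_distrib mult.commute)
    also have "\<dots> = (\<Sum>j<k. u j)"
    proof (intro sum.cong refl)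
      fix j assume "j \<in> {..<k}"
      then have "h (u j) - ?c *\<^sub>R u j = (real j - ?c) *\<^sub>R u j"
        using u by (simp add: weight_space_def algebra_simps)
      moreover have "real j - ?c > 0"
        using False by (simp add: algebra_simps)
      ultimately show "(1 / (real j - ?c)) *\<^sub>R (h (u j) - ?c *\<^sub>R u j) = u j"
        by simp
    qed
    finally have "h (v - z) = ?c *\<^sub>R (v - z)"
      using s by (simp add: lin_simps algebra_simps)
    then have "v - z \<in> weight_space (of_int (w - 2))"
      by (simp add: weight_space_def)
    then have "v - z \<in> span weight_vectors"
      unfolding weight_vectors_def by (intro span_base) blast
    moreover have "e z = 0"
      using u by (simp add: z_def linear_sum[OF lin_e] lin_simps)
    ultimately show ?thesis
      using y(2) by (intro bexI[of _ "v - z"]) (auto simp: lin_simps)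
  qed
  have "v \<in> span weight_vectors" if "(e ^^ k) v = 0" for k v
    using that
  proof (induction k arbitrary: v)
    case 0
    then show ?case by (simp add: span_zero)
  next
    case (Suc k)
    then have "e v \<in> span weight_vectors"
      by (simp add: funpow_swap1)
    then obtain A y where A: "finite A" "\<And>w. w \<in> A \<Longrightarrow> y w \<in> weight_space (of_int w)"
      and s: "e v = (\<Sum>w\<in>A. y w)"
      using weight_vectors_span_decomposition by meson
    have "(\<Sum>x\<in>of_int ` A. y \<lfloor>x::real\<rfloor>) = e v"
      by (subst sum.reindex) (auto simp: s inj_on_def)
    moreover have "subspace (range e)"
      using linear_subspace_image[OF lin_e subspace_UNIV] .
    moreover have "h u \<in> range e" if u: "u \<in> range e" for u
    proof -
      obtain t where "u = e t" using u by blast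
      then have "h u = e (h t + 2 *\<^sub>R t)" by (simp add: he lin_simps)
      then show ?thesis by blast
    qed
    ultimately have "\<forall>x\<in>of_int ` A. y \<lfloor>x::real\<rfloor> \<in> range e"
      using A by (intro weight_components_mem[OF lin_h]) (auto simp: weight_space_def)
    then have "\<exists>z. z \<in> span weight_vectors \<and> e z = y w" if "w \<in> A" for w
      using lift[OF A(2)[OF that]] that by (metis floor_of_int imageE imageI)
    then obtain z where z: "\<And>w. w \<in> A \<Longrightarrow> z w \<in> span weight_vectors \<and> e (z w) = y w"
      by metis
    have "e (v - (\<Sum>w\<in>A. z w)) = 0"
      using s z by (simp add: lin_simps linear_sum[OF lin_e])
    then have "v - (\<Sum>w\<in>A. z w) \<in> span weight_vectors"
      by (rule base)
    moreover have "(\<Sum>w\<in>A. z w) \<in> span weight_vectors"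
      using z by (intro span_sum) auto
    ultimately show ?case
      using span_add by fastforce
  qed
  then show ?thesis
    using e_nilpotent by blast
qed

end

section \<open>Weights in dimension five\<close>

lemma image_mset_eq_mset_imp_map_eq:
  "image_mset f A = mset ys \<Longrightarrow> \<exists>xs. mset xs = A \<and> map f xs = ys"
proof (induction ys arbitrary: A)
  case Nil
  then show ?case by auto
next
  case (Cons y ys)
  then obtain A' a where "A = add_mset a A'" "f a = y" "image_mset f A' = mset ys"
    by (auto dest: msed_map_invR)
  then show ?case
    using Cons.IH by (metis list.simps(9) mset.simps(2))
qed

text \<open>The symmetric unimodal multisets with five elements are \<open>{a, b, 0, -b, -a}\<close> for the seven pairs
listed in the proof. In the conclusion the elements are arranged so that the form with
coefficients \<open>0, 0, 1, 2, 3\<close> vanishes.\<close>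

lemma sl2_weight_multisets_of_size_5:
  fixes M :: "int multiset"
  assumes size: "size M = 5" and sym: "\<And>w. count M (- w) = count M w"
    and unimodal: "\<And>w. w > 0 \<Longrightarrow> count M w \<le> count M (w - 2)"
  shows "\<exists>w1 w2 w3 w4 w5. M = {#w1, w2, w3, w4, w5#} \<and>
    w1 + w2 + w3 + w4 + w5 = 0 \<and> w3 + 2 * w4 + 3 * w5 = 0"
proof -
  define xs where "xs = sorted_list_of_multiset M"
  have xs: "sorted xs" "mset xs = M" "length xs = 5"
    using size unfolding xs_def
    by (simp, simp, metis mset_sorted_list_of_multiset size_mset)
  have "image_mset uminus M = M"
  proof (rule multiset_eqI)
    fix x
    have "uminus -` {x} \<inter> set_mset M = (if - x \<in># M then {- x} else {})"
      by auto
    then have "count (image_mset uminus M) x = count M (- x)"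
      by (simp add: count_image_mset not_in_iff)
    then show "count (image_mset uminus M) x = count M x"
      using sym[of x] by simp
  qed
  then have "mset (rev (map uminus xs)) = mset xs"
    using xs(2) by simp
  moreover have "sorted (rev (map uminus xs))"
    using xs(1) by (simp add: sorted_wrt_rev sorted_wrt_map)
  ultimately have rev: "rev (map uminus xs) = xs"
    using xs(1) by (metis sorted_list_of_multiset_mset sorted_sort_id)
  obtain x1 x2 x3 x4 x5 where x: "xs = [x1, x2, x3, x4, x5]"
    using xs(3) by (auto simp: numeral_eq_Suc length_Suc_conv)
  obtain a b where ab: "xs = [- a, - b, 0, b, a]" "0 \<le> b" "b \<le> a"
    using rev xs(1) unfolding x by auto
  have M: "M = {#- a, - b, 0, b, a#}"
    using xs(2) unfolding ab(1) by simp
  have step: "count M w \<noteq> 0 \<Longrightarrow> w > 0 \<Longrightarrow> w - 2 \<in> {- a, - b, 0, b, a}" for w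
    using unimodal[of w] by (auto simp: M split: if_splits)
  \<comment> \<open>In the case excluded here the weight 2 would have larger multiplicity than the weight 0.\<close>
  have "(a, b) \<noteq> (2, 2)"
    using unimodal[of 2] by (auto simp: M)
  moreover have "a \<le> 0 \<or> a - 2 \<in> {- a, - b, 0, b, a}" "b \<le> 0 \<or> b - 2 \<in> {- a, - b, 0, b, a}"
    using step[of a] step[of b] by (auto simp: M)
  ultimately have "(a, b) \<in> {(0, 0), (1, 0), (2, 0), (1, 1), (2, 1), (3, 1), (4, 2)}"
    using ab(2,3) unfolding insert_iff empty_iff prod.inject by presburger
  then consider "b = 0" | "a = 1" "b = 1" | "a = 2 * b" | "a = 3" "b = 1"
    by auto
  moreover have solution: ?thesis
    if "M = {#w1, w2, w3, w4, w5#}" "w1 + w2 + w3 + w4 + w5 = 0" "w3 + 2 * w4 + 3 * w5 = 0"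
    for w1 w2 w3 w4 w5
    using that by blast
  ultimately show ?thesis
  proof cases
    case 1
    then have "M = {#a, - a, 0, 0, 0#}" by (simp add: M add_mset_commute)
    from solution[OF this] show ?thesis by simp
  next
    case 2
    then have "M = {#1, 0, - 1, - 1, 1#}" by (simp add: M add_mset_commute)
    from solution[OF this] show ?thesis by simp
  next
    case 3
    then have "M = {#- 2 * b, b, 2 * b, - b, 0#}" by (simp add: M add_mset_commute)
    from solution[OF this] show ?thesis by simp
  next
    case 4
    then have "M = {#1, 0, - 3, 3, - 1#}" by (simp add: M add_mset_commute)
    from solution[OF this] show ?thesis by simp
  qed
qed

text \<open>The operator \<open>s\<close> stands for the non-trivial element of the Weyl group, which reverses weights.\<close>

locale sl2_triple_weyl = sl2_triple +
  fixes s :: "'a \<Rightarrow> 'a"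
  assumes lin_s: "linear s" and inj_s: "inj s" and hs: "h (s v) = - s (h v)"
begin

lemma dim_weight_space_uminus: "dim (weight_space (- x)) = dim (weight_space x)"
proof -
  have "dim (weight_space y) \<le> dim (weight_space (- y))" for y
  proof -
    have "dim (weight_space y) = dim (s ` weight_space y)"
      using inj_s by (intro dim_image_eq[symmetric] lin_s) (auto intro: inj_on_subset)
    also have "\<dots> \<le> dim (weight_space (- y))"
      by (intro dim_subset) (auto simp: weight_space_def hs linear_scale[OF lin_s])
    finally show ?thesis .
  qed
  from this[of x] this[of "- x"] show ?thesis by simp
qed

text \<open>Lowering is injective on weight spaces of positive weight, because a vector killed by \<open>f\<close> has
non-positive weight.\<close>

lemma dim_weight_space_mono:
  assumes "x > 0"
  shows "dim (weight_space x) \<le> dim (weight_space (x - 2))"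
proof -
  have "inj_on f (weight_space x)"
  proof (rule inj_onI)
    fix u v assume *: "u \<in> weight_space x" "v \<in> weight_space x" "f u = f v"
    then have "u - v \<in> weight_space x"
      using subspace_weight_space by (intro subspace_diff)
    then show "u = v"
      using f_injective[of "u - v" x] *(3) assms by (simp add: lin_simps)
  qed
  then have "dim (weight_space x) = dim (f ` weight_space x)"
    using lin_f subspace_weight_space
    by (intro dim_image_eq[symmetric]) (auto simp: span_eq_iff[THEN iffD2])
  also have "\<dots> \<le> dim (weight_space (x - 2))"
    using f_weight by (intro dim_subset) auto
  finally show ?thesis .
qed

lemma weight_basis:
  "\<exists>B wt. independent B \<and> span B = UNIV \<and> (\<forall>b\<in>B. b \<in> weight_space (of_int (wt b))) \<and>
     (\<forall>w::int. card {b\<in>B. wt b = w} = dim (weight_space (of_int w)))"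
proof -
  obtain B where B: "B \<subseteq> weight_vectors" "independent B" "weight_vectors \<subseteq> span B"
    using maximal_independent_subset by blast
  have spB: "span B = UNIV"
    using B(3) span_weight_vectors span_mono[OF B(3)] by (simp add: span_span top.extremum_unique)
  have fin: "finite B"
    using B(2) independent_imp_finite by blast
  have "\<forall>b\<in>B. \<exists>w::int. b \<in> weight_space (of_int w)"
    using B(1) by (auto simp: weight_vectors_def)
  then obtain wt where wt: "\<And>b. b \<in> B \<Longrightarrow> b \<in> weight_space (of_int (wt b))"
    by metis
  have "card {b\<in>B. wt b = w} = dim (weight_space (of_int w))" for w
  proof (rule dim_unique[symmetric])
    show "{b\<in>B. wt b = w} \<subseteq> weight_space (of_int w)"
      using wt by auto
    show "independent {b\<in>B. wt b = w}"
      using B(2) by (rule independent_mono) auto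
    show "weight_space (of_int w) \<subseteq> span {b\<in>B. wt b = w}"
    proof
      fix v assume v: "v \<in> weight_space (of_int w)"
      obtain r where r: "v = (\<Sum>b\<in>B. r b *\<^sub>R b)"
        using spB fin by (auto simp: span_finite)
      have "0 = h v - of_int w *\<^sub>R v"
        using v by (simp add: weight_space_def)
      also have "\<dots> = (\<Sum>b\<in>B. r b *\<^sub>R h b - of_int w *\<^sub>R r b *\<^sub>R b)"
        by (simp add: r linear_sum[OF lin_h] lin_simps scaleR_sum_right sum_subtractf)
      also have "\<dots> = (\<Sum>b\<in>B. (r b * (of_int (wt b) - of_int w)) *\<^sub>R b)"
        using wt by (intro sum.cong refl) (simp add: weight_space_def algebra_simps)
      finally have "(\<Sum>b\<in>B. (r b * (of_int (wt b) - of_int w)) *\<^sub>R b) = 0"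
        by (rule sym)
      from independentD[OF B(2) fin subset_refl this]
      have "r b = 0" if "b \<in> B" "wt b \<noteq> w" for b
        using that by fastforce
      then have *: "v = (\<Sum>b\<in>{b\<in>B. wt b = w}. r b *\<^sub>R b)"
        unfolding r using fin by (intro sum.mono_neutral_right) auto
      show "v \<in> span {b\<in>B. wt b = w}"
        unfolding * by (intro span_sum span_scale span_base)
    qed
  qed (rule refl)
  then show ?thesis
    using B(2) spB wt by blast
qed

lemma weight_basis_dim_5:
  assumes "DIM('a) = 5"
  shows "\<exists>bs w1 w2 w3 w4 w5. length bs = 5 \<and> independent (set bs) \<and> distinct bs \<and>
    list_all2 (\<lambda>b w. h b = of_int w *\<^sub>R b) bs [w1, w2, w3, w4, w5] \<and>
    w1 + w2 + w3 + w4 + w5 = 0 \<and> w3 + 2 * w4 + 3 * w5 = 0"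
proof -
  obtain B wt where B: "independent B" "span B = UNIV" "\<forall>b\<in>B. b \<in> weight_space (of_int (wt b))"
    and card: "\<And>w::int. card {b\<in>B. wt b = w} = dim (weight_space (of_int w))"
    using weight_basis by blast
  have fin: "finite B"
    using B(1) independent_imp_finite by blast
  define M where "M = image_mset wt (mset_set B)"
  have M: "count M w = dim (weight_space (of_int w))" for w
    using fin card[of w] by (simp add: M_def count_image_mset_eq_card_vimage)
  have "card B = dim (span B)"
    using B(1) by (simp add: dim_eq_card_independent)
  then have "size M = 5"
    using B(2) assms by (simp add: M_def)
  moreover have "count M w \<le> count M (w - 2)" if "w > 0" for w
    using dim_weight_space_mono[of "of_int w"] that by (simp add: M)
  moreover have "count M (- w) = count M w" for w
    using dim_weight_space_uminus[of "of_int w"] by (simp add: M)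
  ultimately obtain w1 w2 w3 w4 w5 where w: "M = mset [w1, w2, w3, w4, w5]"
      "w1 + w2 + w3 + w4 + w5 = 0" "w3 + 2 * w4 + 3 * w5 = 0"
    using sl2_weight_multisets_of_size_5[of M] by auto
  then obtain bs where bs: "mset bs = mset_set B" "map wt bs = [w1, w2, w3, w4, w5]"
    using image_mset_eq_mset_imp_map_eq unfolding M_def by metis
  have "set bs = B"
    using bs(1) fin by (metis finite_set_mset_mset_set set_mset_mset)
  moreover have "distinct bs"
    using fin \<open>set bs = B\<close> by (simp add: distinct_count_atmost_1 bs(1) count_mset_set')
  moreover have "list_all2 (\<lambda>b w. h b = of_int w *\<^sub>R b) bs (map wt bs)"
    using B(3) \<open>set bs = B\<close> by (auto simp: list_all2_map2 list_all2_same weight_space_def)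
  moreover have "length bs = 5"
    using arg_cong[OF bs(2), of length] by simp
  ultimately show ?thesis
    using B(1) w(2,3) unfolding bs(2) by blast
qed

end

section \<open>Products of matrices and literals for matrices of size two\<close>

text \<open>Bilinearity supplies the product rule for curves of matrices.\<close>

lemma bounded_bilinear_matrix_mult:
  "bounded_bilinear ((**) :: real^'n^'m \<Rightarrow> real^'p^'n \<Rightarrow> real^'p^'m)"
  unfolding bilinear_conv_bounded_bilinear[symmetric] bilinear_def
  by (intro conjI allI linearI)
     (simp_all add: vec_eq_iff matrix_matrix_mult_def sum.distrib sum_distrib_left algebra_simps)

lemma bounded_bilinear_matrix_vector_mult:
  "bounded_bilinear ((*v) :: real^'n^'m \<Rightarrow> real^'n \<Rightarrow> real^'m)"
  unfolding bilinear_conv_bounded_bilinear[symmetric] bilinear_def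
  by (intro conjI allI linearI)
     (simp_all add: vec_eq_iff matrix_vector_mult_def sum.distrib sum_distrib_left algebra_simps)

lemmas has_vector_derivative_matrix_mult =
  bounded_bilinear.has_vector_derivative[OF bounded_bilinear_matrix_mult]

lemmas has_vector_derivative_matrix_vector_mult =
  bounded_bilinear.has_vector_derivative[OF bounded_bilinear_matrix_vector_mult]

definition mat2 :: "real \<Rightarrow> real \<Rightarrow> real \<Rightarrow> real \<Rightarrow> real^2^2" where
  "mat2 a b c d = (\<chi> i j. if i = 1 then if j = 1 then a else b else if j = 1 then c else d)"

lemma mat2_nth [simp]:
  "mat2 a b c d $ 1 $ 1 = a" "mat2 a b c d $ 1 $ 2 = b"
  "mat2 a b c d $ 2 $ 1 = c" "mat2 a b c d $ 2 $ 2 = d"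
  by (simp_all add: mat2_def)

lemma mat2_eqI:
  fixes A B :: "real^2^2"
  assumes "A $ 1 $ 1 = B $ 1 $ 1" "A $ 1 $ 2 = B $ 1 $ 2" "A $ 2 $ 1 = B $ 2 $ 1" "A $ 2 $ 2 = B $ 2 $ 2"
  shows "A = B"
  using assms by (simp add: vec_eq_iff forall_2)

lemma mat2_mult:
  "mat2 a b c d ** mat2 a' b' c' d' =
    mat2 (a * a' + b * c') (a * b' + b * d') (c * a' + d * c') (c * b' + d * d')"
  by (rule mat2_eqI) (simp_all add: matrix_matrix_mult_def sum_2)

lemma mat2_arith:
  "mat2 a b c d + mat2 a' b' c' d' = mat2 (a + a') (b + b') (c + c') (d + d')"
  "mat2 a b c d - mat2 a' b' c' d' = mat2 (a - a') (b - b') (c - c') (d - d')"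
  "- mat2 a b c d = mat2 (- a) (- b) (- c) (- d)"
  "r *\<^sub>R mat2 a b c d = mat2 (r * a) (r * b) (r * c) (r * d)"
  "mat 1 = mat2 1 0 0 1"
  by (rule mat2_eqI; simp add: mat_def)+

lemma det_mat2: "det (mat2 a b c d) = a * d - b * c"
  by (simp add: det_2)

section \<open>Differentiating homomorphisms between special linear groups\<close>

text \<open>What is used of a smooth homomorphism: it maps curves through the identity with tangent vector \<open>Y\<close>
to curves with tangent vector \<open>D Y\<close>, for one linear map \<open>D\<close>.\<close>

locale differentiable_SL_hom =
  fixes \<Phi> :: "real^'m^'m \<Rightarrow> real^'n^'n" and D :: "real^'m^'m \<Rightarrow> real^'n^'n"
  assumes mult: "det A = 1 \<Longrightarrow> det B = 1 \<Longrightarrow> \<Phi> (A ** B) = \<Phi> A ** \<Phi> B"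
    and one: "\<Phi> (mat 1) = mat 1"
    and linear_D: "linear D"
    and tangent: "(\<And>t. det (c t) = 1) \<Longrightarrow> c 0 = mat 1 \<Longrightarrow> (c has_vector_derivative Y) (at 0) \<Longrightarrow>
      ((\<lambda>t. \<Phi> (c t)) has_vector_derivative D Y) (at 0)"
begin

lemma D_adjoint:
  assumes g: "det g = 1" "det g' = 1" "g ** g' = mat 1"
    and c: "\<And>t. det (c t) = 1" "c 0 = mat 1" "(c has_vector_derivative Y) (at 0)"
  shows "D (g ** Y ** g') = \<Phi> g ** D Y ** \<Phi> g'"
proof -
  have "((\<lambda>t. g ** c t ** g') has_vector_derivative g ** Y ** g') (at 0)"
    using has_vector_derivative_matrix_mult[OF has_vector_derivative_matrix_mult
        [OF has_vector_derivative_const c(3)] has_vector_derivative_const]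
    by simp
  then have "((\<lambda>t. \<Phi> (g ** c t ** g')) has_vector_derivative D (g ** Y ** g')) (at 0)"
    by (rule tangent[rotated 2]) (use g c in \<open>simp_all add: det_mul\<close>)
  moreover have "\<Phi> (g ** c t ** g') = \<Phi> g ** \<Phi> (c t) ** \<Phi> g'" for t
    using g c by (simp add: mult det_mul)
  moreover have "((\<lambda>t. \<Phi> g ** \<Phi> (c t) ** \<Phi> g') has_vector_derivative \<Phi> g ** D Y ** \<Phi> g') (at 0)"
    using has_vector_derivative_matrix_mult[OF has_vector_derivative_matrix_mult
        [OF has_vector_derivative_const tangent[OF c]] has_vector_derivative_const]
    by simp
  ultimately show ?thesis
    by (simp add: vector_derivative_unique_at)
qed

text \<open>Differentiating \<open>D (z(t) Y z(t)\<inverse>) = \<Phi>(z(t)) (D Y) \<Phi>(z(t)\<inverse>)\<close> at \<open>t = 0\<close>. The inverse curve is passed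
as \<open>z'\<close>, with its derivative \<open>- Z\<close>.\<close>

lemma D_bracket:
  assumes z: "\<And>t. det (z t) = 1" "z 0 = mat 1" "(z has_vector_derivative Z) (at 0)"
    and z': "\<And>t. det (z' t) = 1" "z' 0 = mat 1" "(z' has_vector_derivative - Z) (at 0)"
    and inverse: "\<And>t. z t ** z' t = mat 1"
    and c: "\<And>t. det (c t) = 1" "c 0 = mat 1" "(c has_vector_derivative Y) (at 0)"
  shows "D (Z ** Y - Y ** Z) = D Z ** D Y - D Y ** D Z"
proof -
  have bl: "bounded_linear D"
    using linear_D linear_conv_bounded_linear by blast
  have "((\<lambda>t. z t ** Y ** z' t) has_vector_derivative Z ** Y - Y ** Z) (at 0)"
    using has_vector_derivative_matrix_mult[OF has_vector_derivative_matrix_mult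
        [OF z(3) has_vector_derivative_const] z'(3)]
    by (simp add: z z' bounded_bilinear.minus_right[OF bounded_bilinear_matrix_mult])
  then have "((\<lambda>t. D (z t ** Y ** z' t)) has_vector_derivative D (Z ** Y - Y ** Z)) (at 0)"
    by (rule bounded_linear.has_vector_derivative[OF bl])
  moreover have "D (z t ** Y ** z' t) = \<Phi> (z t) ** D Y ** \<Phi> (z' t)" for t
    by (rule D_adjoint[OF z(1) z'(1) inverse c])
  moreover have "((\<lambda>t. \<Phi> (z t) ** D Y ** \<Phi> (z' t)) has_vector_derivative D Z ** D Y - D Y ** D Z) (at 0)"
    using has_vector_derivative_matrix_mult[OF has_vector_derivative_matrix_mult
        [OF tangent[OF z] has_vector_derivative_const] tangent[OF z']]
    by (simp add: z z' one linear_neg[OF linear_D]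
        bounded_bilinear.minus_right[OF bounded_bilinear_matrix_mult])
  ultimately show ?thesis
    by (simp add: vector_derivative_unique_at)
qed

end

lemma lie_group_hom_SL_differentiable:
  fixes \<Phi> :: "real^'m^'m \<Rightarrow> real^'n^'n"
  assumes "lie_group_hom_SL \<Phi>"
  shows "\<exists>D. differentiable_SL_hom \<Phi> D"
proof -
  have hom: "\<Phi> \<in> hom SL SL" and smooth: "smooth_map_on (carrier SL) \<Phi>"
    using assms by (auto simp: lie_group_hom_SL_def)
  have mult: "\<Phi> (A ** B) = \<Phi> A ** \<Phi> B" if "det A = 1" "det B = 1" for A B
    using hom_mult[OF hom, of A B] that by (simp add: SL_def)
  have one: "\<Phi> (mat 1) = mat 1"
    using hom_one[OF hom group_SL group_SL] by (simp add: SL_def)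
  have "(mat 1 :: real^'m^'m) \<in> carrier SL"
    by (simp add: SL_def)
  then obtain U F where U: "open U" "mat 1 \<in> U" and F: "\<forall>k. C_k k F U"
    and eq: "\<And>y. y \<in> carrier SL \<inter> U \<Longrightarrow> F y = \<Phi> y"
    using smooth unfolding smooth_map_on_def by meson
  have "F differentiable_on U"
    using F[rule_format, of "Suc 0"] by simp
  then have "F differentiable (at (mat 1))"
    using U by (simp add: differentiable_on_eq_differentiable_at)
  then obtain D where D: "(F has_derivative D) (at (mat 1))"
    by (auto simp: differentiable_def)
  show ?thesis
  proof (intro exI differentiable_SL_hom.intro mult one)
    show "linear D"
      using D has_derivative_linear by blast
    fix c :: "real \<Rightarrow> real^'m^'m" and Y
    assume c: "\<And>t. det (c t) = 1" "c 0 = mat 1" "(c has_vector_derivative Y) (at 0)"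
    have "((F \<circ> c) has_vector_derivative D Y) (at 0)"
      using c(2,3) D by (intro vector_derivative_diff_chain_within) (auto intro: has_derivative_at_withinI)
    moreover have "\<forall>\<^sub>F t in at 0. c t \<in> U"
      using has_vector_derivative_continuous[OF c(3)] U c(2)
      by (auto simp: continuous_at_imp_continuous_at_within  continuous_at topological_tendstoD isCont_def)
    then have "\<forall>\<^sub>F t in nhds 0. c t \<in> U"
      using U c(2) by (simp add: eventually_nhds_conv_at)
    then have "\<forall>\<^sub>F t in nhds 0. (F \<circ> c) t = \<Phi> (c t)"
      by eventually_elim (use c eq in \<open>auto simp: SL_def\<close>)
    ultimately show "((\<lambda>t. \<Phi> (c t)) has_vector_derivative D Y) (at 0)"
      by (subst (asm) has_vector_derivative_cong_ev[where g = "\<lambda>t. \<Phi> (c t)"])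
         (auto dest: eventually_nhds_x_imp_x)
  qed
qed

section \<open>Indices in dimension five\<close>

lemma exhaust_5:
  fixes x :: 5
  shows "x = 1 \<or> x = 2 \<or> x = 3 \<or> x = 4 \<or> x = 5"
proof (induct x)
  case (of_int z)
  then have "z = 0 \<or> z = 1 \<or> z = 2 \<or> z = 3 \<or> z = 4" by fastforce
  then show ?case by auto
qed

lemma forall_5: "(\<forall>i::5. P i) \<longleftrightarrow> P 1 \<and> P 2 \<and> P 3 \<and> P 4 \<and> P 5"
  by (metis exhaust_5)

lemma UNIV_5: "UNIV = {1, 2, 3, 4, 5::5}"
  using exhaust_5 by auto

lemma sum_5: "sum f (UNIV::5 set) = f 1 + f 2 + f 3 + f 4 + f 5"
  unfolding UNIV_5 by (simp add: ac_simps)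

lemma prod_5: "prod f (UNIV::5 set) = f 1 * f 2 * f 3 * f 4 * f 5"
  unfolding UNIV_5 by (simp add: ac_simps)

text \<open>A literal for functions on the five indices, in the order \<open>1, 2, 3, 4, 5\<close>. In the type \<open>5\<close> the last
index equals \<open>0\<close>.\<close>

definition vec5 :: "'a \<Rightarrow> 'a \<Rightarrow> 'a \<Rightarrow> 'a \<Rightarrow> 'a \<Rightarrow> 5 \<Rightarrow> 'a" where
  "vec5 a b c d e i = (if i = 1 then a else if i = 2 then b else if i = 3 then c else if i = 4 then d else e)"

lemma vec5_nth [simp]:
  "vec5 a b c d e 1 = a" "vec5 a b c d e 2 = b" "vec5 a b c d e 3 = c" "vec5 a b c d e 4 = d"
  "vec5 a b c d e 5 = e"
  by (simp_all add: vec5_def)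

section \<open>Diagonal matrices and their exponentials\<close>

definition diagonal :: "real^'n \<Rightarrow> real^'n^'n" where
  "diagonal d = (\<chi> i j. if i = j then d $ i else 0)"

lemma diagonal_nth [simp]: "diagonal d $ i $ j = (if i = j then d $ i else 0)"
  by (simp add: diagonal_def)

lemma matrix_mult_diagonal_nth: "(A ** diagonal d) $ i $ j = A $ i $ j * d $ j"
  by (simp add: matrix_matrix_mult_def if_distrib cong: if_cong)

lemma diagonal_matrix_mult_nth: "(diagonal d ** A) $ i $ j = d $ i * A $ i $ j"
  by (simp add: matrix_matrix_mult_def if_distrib if_distribR cong: if_cong)

lemma diagonal_mult: "diagonal c ** diagonal d = diagonal (\<chi> i. c $ i * d $ i)"
  by (simp add: vec_eq_iff matrix_mult_diagonal_nth)

lemma diagonal_1: "diagonal 1 = mat 1"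
  by (simp add: vec_eq_iff mat_def)

lemma det_diagonal: "det (diagonal d) = (\<Prod>i\<in>UNIV. d $ i)"
  by (subst det_diagonal) simp_all

lemma linear_diagonal: "linear diagonal"
  by (intro linearI) (simp_all add: vec_eq_iff)

lemma matrix_exp_diagonal: "matrix_exp (diagonal d) = diagonal (\<chi> i. exp (d $ i))"
proof -
  have pow: "((\<lambda>B. diagonal d ** B) ^^ k) (mat 1) = diagonal (\<chi> i. (d $ i) ^ k)" for k
    by (induction k) (simp_all add: diagonal_mult, simp_all add: vec_eq_iff mat_def)
  have bl: "bounded_linear (diagonal :: real^'n \<Rightarrow> real^'n^'n)"
    using linear_diagonal linear_conv_bounded_linear by blast
  have "(\<lambda>k. (\<chi> i. (1 / fact k) * (d $ i) ^ k)) sums (\<chi> i. exp (d $ i))"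
    unfolding sums_def
  proof (rule vec_tendstoI)
    fix i
    have "(\<lambda>n. \<Sum>k<n. (1 / fact k) * (d $ i) ^ k) \<longlonglongrightarrow> exp (d $ i)"
      using exp_converges[of "d $ i"] by (simp add: sums_def divide_inverse)
    then show "(\<lambda>n. (\<Sum>k<n. \<chi> i. (1 / fact k) * (d $ i) ^ k) $ i) \<longlonglongrightarrow> (\<chi> i. exp (d $ i)) $ i"
      by simp
  qed
  then have "(\<lambda>k. diagonal (\<chi> i. (1 / fact k) * (d $ i) ^ k)) sums diagonal (\<chi> i. exp (d $ i))"
    by (rule bounded_linear.sums[OF bl])
  moreover have "diagonal (\<chi> i. (1 / fact k) * (d $ i) ^ k) =
      (1 / fact k) *\<^sub>R ((\<lambda>B. diagonal d ** B) ^^ k) (mat 1)" for k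
    by (simp add: pow vec_eq_iff)
  ultimately show ?thesis
    unfolding matrix_exp_def by (simp add: sums_iff)
qed

section \<open>The split abelian group\<close>

text \<open>The diagonals of the matrices in the Lie algebra of \<open>H\<close>.\<close>

definition log_H :: "(real^5) set" where
  "log_H = {x. (\<Sum>i\<in>UNIV. x $ i) = 0 \<and> (\<Sum>i\<in>UNIV. vec5 0 0 1 2 3 i * x $ i) = 0}"

definition H :: "(real^5^5) set" where
  "H = (\<lambda>x. diagonal (\<chi> i. exp (x $ i))) ` log_H"

lemma subspace_log_H: "subspace log_H"
  unfolding subspace_def log_H_def
  by (auto simp: sum.distrib algebra_simps simp flip: sum_distrib_left)

lemma det_H: "A \<in> H \<Longrightarrow> det A = 1"
  by (auto simp: H_def log_H_def det_diagonal simp flip: exp_sum)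

lemma subgroup_H: "subgroup H SL"
proof (rule group.subgroupI[OF group_SL])
  show "H \<subseteq> carrier SL"
    by (auto simp: SL_def det_H)
  show "H \<noteq> {}"
    using subspace_0[OF subspace_log_H] by (auto simp: H_def)
next
  fix A B assume "A \<in> H" "B \<in> H"
  then obtain x y where "x \<in> log_H" "y \<in> log_H" "A = diagonal (\<chi> i. exp (x $ i))"
      "B = diagonal (\<chi> i. exp (y $ i))"
    by (auto simp: H_def)
  then show "A \<otimes>\<^bsub>SL\<^esub> B \<in> H"
    using subspace_add[OF subspace_log_H]
    by (auto simp: SL_def H_def diagonal_mult exp_add[symmetric] intro!: image_eqI[of _ _ "x + y"])
next
  fix A assume "A \<in> H"
  then obtain x where x: "x \<in> log_H" "A = diagonal (\<chi> i. exp (x $ i))"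
    by (auto simp: H_def)
  let ?B = "diagonal (\<chi> i. exp ((- x) $ i))"
  have "?B \<in> H"
    using x subspace_neg[OF subspace_log_H] unfolding H_def by blast
  moreover have "?B ** A = mat 1"
    unfolding x(2) diagonal_mult diagonal_1[symmetric]
    by (simp add: vec_eq_iff exp_minus)
  ultimately have "inv\<^bsub>SL\<^esub> A = ?B"
    using \<open>A \<in> H\<close> det_H by (intro group.inv_equality[OF group_SL]) (auto simp: SL_def)
  then show "inv\<^bsub>SL\<^esub> A \<in> H"
    using \<open>?B \<in> H\<close> by simp
qed

lemma dim_log_H: "dim log_H = 3"
proof -
  define p :: "real^3 \<Rightarrow> real^5" where
    "p c = (\<chi> i. vec5 (- c $ 1 + c $ 2 + 2 * c $ 3) (c $ 1) (- 2 * c $ 2 - 3 * c $ 3) (c $ 2) (c $ 3) i)"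
    for c
  have "linear p"
    by (intro linearI) (simp_all add: p_def vec_eq_iff forall_5 algebra_simps)
  moreover have "inj p"
    by (rule injI) (simp add: p_def vec_eq_iff forall_5 forall_3)
  moreover have "range p = log_H"
  proof
    show "range p \<subseteq> log_H"
      by (auto simp: p_def log_H_def sum_5)
    show "log_H \<subseteq> range p"
    proof
      fix x assume "x \<in> log_H"
      then have "x = p (\<chi> i. if i = 1 then x $ 2 else if i = 2 then x $ 4 else x $ 5)"
        by (simp add: p_def log_H_def sum_5 vec_eq_iff forall_5)
      then show "x \<in> range p" by blast
    qed
  qed
  ultimately have "dim log_H = dim (UNIV :: (real^3) set)"
    using dim_image_eq[of p UNIV] by simp
  then show ?thesis by simp
qed

lemma split_abelian_subgroup_H: "split_abelian_subgroup 3 H"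
proof -
  let ?h = "diagonal ` log_H"
  have sub: "subspace ?h"
    by (rule linear_subspace_image[OF linear_diagonal subspace_log_H])
  have inj: "inj (diagonal :: real^5 \<Rightarrow> real^5^5)"
    by (rule injI) (metis diagonal_nth vec_eq_iff)
  have "abelian_subalgebra_sl ?h"
    unfolding abelian_subalgebra_sl_def
    using sub by (auto simp: trace_def log_H_def diagonal_mult mult.commute)
  moreover have "dim ?h = 3"
    using dim_image_eq[OF linear_diagonal, of log_H] inj inj_on_subset dim_log_H by fastforce
  moreover have "(\<lambda>X. mat 1 ** X ** matrix_inv (mat 1)) ` ?h = ?h"
  proof -
    have "matrix_inv (mat 1 :: real^5^5) = mat 1"
      unfolding matrix_inv_def by (rule some_equality) auto
    then show ?thesis by simp
  qed
  moreover have "?h \<subseteq> traceless_diagonal"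
    by (auto simp: traceless_diagonal_def trace_def log_H_def)
  moreover have "H = matrix_exp ` ?h"
    by (simp add: H_def image_image matrix_exp_diagonal)
  moreover have "mat 1 \<in> carrier (SL :: (real^5^5) monoid)"
    by (simp add: SL_def)
  ultimately show ?thesis
    unfolding split_abelian_subgroup_def using subgroup_H sub by blast
qed

section \<open>Non-properness of SL(2)-actions\<close>

lemma SL2_curve_derivatives:
  "((\<lambda>t. mat2 1 t 0 1) has_vector_derivative mat2 0 1 0 0) (at 0)"
  "((\<lambda>t. mat2 1 0 t 1) has_vector_derivative mat2 0 0 1 0) (at 0)"
  "((\<lambda>t. mat2 1 (- t) 0 1) has_vector_derivative - mat2 0 1 0 0) (at 0)"
  "((\<lambda>t. mat2 1 0 (- t) 1) has_vector_derivative - mat2 0 0 1 0) (at 0)"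
  "((\<lambda>t. mat2 (exp t) 0 0 (exp (- t))) has_vector_derivative mat2 1 0 0 (- 1)) (at 0)"
proof -
  have eq: "mat2 a b c d = a *\<^sub>R mat2 1 0 0 0 + b *\<^sub>R mat2 0 1 0 0 + c *\<^sub>R mat2 0 0 1 0 + d *\<^sub>R mat2 0 0 0 1"
    for a b c d
    by (simp add: mat2_arith)
  have *: "((\<lambda>t. mat2 (a t) (b t) (c t) (d t)) has_vector_derivative mat2 a' b' c' d') (at 0)"
    if "(a has_field_derivative a') (at 0)" "(b has_field_derivative b') (at 0)"
      "(c has_field_derivative c') (at 0)" "(d has_field_derivative d') (at 0)" for a b c d a' b' c' d'
    unfolding eq[of "_ _"] eq[of a' b' c' d']
    using that by (auto intro!: derivative_eq_intros)
  show "((\<lambda>t. mat2 1 t 0 1) has_vector_derivative mat2 0 1 0 0) (at 0)"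
    "((\<lambda>t. mat2 1 0 t 1) has_vector_derivative mat2 0 0 1 0) (at 0)"
    "((\<lambda>t. mat2 1 (- t) 0 1) has_vector_derivative - mat2 0 1 0 0) (at 0)"
    "((\<lambda>t. mat2 1 0 (- t) 1) has_vector_derivative - mat2 0 0 1 0) (at 0)"
    "((\<lambda>t. mat2 (exp t) 0 0 (exp (- t))) has_vector_derivative mat2 1 0 0 (- 1)) (at 0)"
    by (auto simp: mat2_arith intro!: * derivative_eq_intros)
qed

text \<open>The bracket relations follow by differentiating along the two unipotent one-parameter groups, whose
inverses are explicit. Conjugation by the Weyl element maps \<open>diag(1,-1)\<close> to its negative.\<close>

lemma sl2_triple_weyl_of_SL2_hom:
  fixes \<Phi> :: "real^2^2 \<Rightarrow> real^'n^'n"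
  assumes "differentiable_SL_hom \<Phi> D"
  shows "sl2_triple_weyl ((*v) (D (mat2 0 1 0 0))) ((*v) (D (mat2 0 0 1 0)))
    ((*v) (D (mat2 1 0 0 (- 1)))) ((*v) (\<Phi> (mat2 0 1 (- 1) 0)))"
proof -
  interpret differentiable_SL_hom \<Phi> D by fact
  let ?E = "mat2 0 1 0 0" and ?F = "mat2 0 0 1 0" and ?H = "mat2 1 0 0 (- 1)"
  let ?W = "mat2 0 1 (- 1) 0" and ?W' = "mat2 0 (- 1) 1 0"
  note curve_e = SL2_curve_derivatives(1) and curve_f = SL2_curve_derivatives(2)
    and curve_h = SL2_curve_derivatives(5)
  have "D (?E ** ?F - ?F ** ?E) = D ?E ** D ?F - D ?F ** D ?E"
    by (rule D_bracket[OF _ _ curve_e _ _ SL2_curve_derivatives(3) _ _ _ curve_f])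
       (simp_all add: det_mat2 mat2_mult mat2_arith)
  then have EF: "D ?E ** D ?F = D ?F ** D ?E + D ?H"
    by (simp add: mat2_mult mat2_arith)
  have "D (?E ** ?H - ?H ** ?E) = D ?E ** D ?H - D ?H ** D ?E"
    by (rule D_bracket[OF _ _ curve_e _ _ SL2_curve_derivatives(3) _ _ _ curve_h])
       (simp_all add: det_mat2 mat2_mult mat2_arith flip: exp_add)
  moreover have "?E ** ?H - ?H ** ?E = (- 2) *\<^sub>R ?E"
    by (simp add: mat2_mult mat2_arith)
  ultimately have HE: "D ?H ** D ?E = D ?E ** D ?H + 2 *\<^sub>R D ?E"
    using linear_scale[OF linear_D, of "- 2" ?E] by (simp add: algebra_simps)
  have "D (?F ** ?H - ?H ** ?F) = D ?F ** D ?H - D ?H ** D ?F"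
    by (rule D_bracket[OF _ _ curve_f _ _ SL2_curve_derivatives(4) _ _ _ curve_h])
       (simp_all add: det_mat2 mat2_mult mat2_arith flip: exp_add)
  moreover have "?F ** ?H - ?H ** ?F = 2 *\<^sub>R ?F"
    by (simp add: mat2_mult mat2_arith)
  ultimately have HF: "D ?H ** D ?F = D ?F ** D ?H - 2 *\<^sub>R D ?F"
    using linear_scale[OF linear_D, of 2 ?F] by (simp add: algebra_simps)
  have W: "det ?W = 1" "det ?W' = 1" "?W ** ?W' = mat 1" "?W' ** ?W = mat 1"
    by (simp_all add: det_mat2 mat2_mult mat2_arith)
  have WW: "\<Phi> ?W' ** \<Phi> ?W = mat 1"
    using mult[OF W(2,1)] W(4) one by simp
  have "D (?W ** ?H ** ?W') = \<Phi> ?W ** D ?H ** \<Phi> ?W'"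
    by (rule D_adjoint[OF W(1-3) _ _ curve_h]) (simp_all add: det_mat2 mat2_arith flip: exp_add)
  moreover have "?W ** ?H ** ?W' = - ?H"
    by (simp add: mat2_mult mat2_arith)
  ultimately have "- D ?H = \<Phi> ?W ** D ?H ** \<Phi> ?W'"
    using linear_neg[OF linear_D] by metis
  then have "(- D ?H) ** \<Phi> ?W = \<Phi> ?W ** D ?H"
    using WW by (metis matrix_mul_assoc matrix_mul_rid)
  then have HW: "D ?H ** \<Phi> ?W = - (\<Phi> ?W ** D ?H)"
    by (metis add.inverse_inverse bounded_bilinear.minus_left[OF bounded_bilinear_matrix_mult])
  show ?thesis
  proof (intro sl2_triple_weyl.intro sl2_triple.intro sl2_triple_weyl_axioms.intro)
    show "inj ((*v) (\<Phi> ?W))"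
      by (rule inj_on_inverseI[of _ "(*v) (\<Phi> ?W')"]) (simp add: matrix_vector_mul_assoc WW)
  qed (simp_all add: matrix_vector_mul_assoc EF HE HF HW matrix_vector_mult_add_rdistrib
      matrix_vector_mult_diff_rdistrib scaleR_matrix_vector_assoc
      bounded_bilinear.minus_left[OF bounded_bilinear_matrix_vector_mult])
qed

text \<open>The one-parameter group \<open>A(t) = \<Phi>(diag(exp t, exp (-t)))\<close> satisfies \<open>A' = A X\<close>, so \<open>exp (-tw) A(t) v\<close> has derivative
zero.\<close>

lemma SL2_hom_diagonal_eigenvector:
  fixes \<Phi> :: "real^2^2 \<Rightarrow> real^'n^'n"
  assumes "differentiable_SL_hom \<Phi> D" and v: "D (mat2 1 0 0 (- 1)) *v v = w *\<^sub>R v"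
  shows "\<Phi> (mat2 (exp t) 0 0 (exp (- t))) *v v = exp (t * w) *\<^sub>R v"
proof -
  interpret differentiable_SL_hom \<Phi> D by fact
  define A where "A t = \<Phi> (mat2 (exp t) 0 0 (exp (- t)))" for t
  have A_add: "A (t + s) = A t ** A s" for s t
    unfolding A_def by (subst mult[symmetric]) (simp_all add: det_mat2 mat2_mult flip: exp_add)
  have A': "(A has_vector_derivative A t ** D (mat2 1 0 0 (- 1))) (at t)" for t
  proof -
    have "(A has_vector_derivative D (mat2 1 0 0 (- 1))) (at 0)"
      unfolding A_def
      by (rule tangent[OF _ _ SL2_curve_derivatives(5)]) (simp_all add: det_mat2 mat2_arith flip: exp_add)
    then have "((\<lambda>s. A t ** A s) has_vector_derivative A t ** D (mat2 1 0 0 (- 1))) (at 0)"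
      using has_vector_derivative_matrix_mult[OF has_vector_derivative_const] by fastforce
    then have "((\<lambda>s. A (t + s)) has_vector_derivative A t ** D (mat2 1 0 0 (- 1))) (at 0)"
      by (simp add: A_add)
    then have "((\<lambda>s. A (t + s)) has_vector_derivative A t ** D (mat2 1 0 0 (- 1))) (at (t - t))"
      by simp
    moreover have "((\<lambda>u. u - t) has_vector_derivative 1) (at t)"
      by (auto intro!: derivative_eq_intros)
    ultimately have "((\<lambda>s. A (t + s)) \<circ> (\<lambda>u. u - t) has_vector_derivative
        1 *\<^sub>R (A t ** D (mat2 1 0 0 (- 1)))) (at t)"
      by (intro vector_diff_chain_at)
    then show ?thesis
      by (simp add: o_def)
  qed
  define y where "y t = exp (- (t * w)) *\<^sub>R (A t *v v)" for t
  have "(y has_vector_derivative 0) (at t)" for t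
    unfolding y_def
    by (rule derivative_eq_intros has_vector_derivative_matrix_vector_mult[OF A' has_vector_derivative_const] refl)+
       (simp add: v matrix_vector_mul_assoc[symmetric] matrix_vector_mult_scaleR algebra_simps)
  then obtain c where c: "\<And>t. y t = c"
    using has_vector_derivative_zero_constant[of UNIV y] by auto
  have "A 0 = mat 1"
    using one by (simp add: A_def mat2_arith)
  then have "y t = v"
    using c[of t] c[of 0] by (simp add: y_def)
  then have "exp (t * w) *\<^sub>R v = (exp (t * w) * exp (- (t * w))) *\<^sub>R (A t *v v)"
    by (simp add: y_def flip: scaleR_scaleR)
  then show ?thesis
    by (simp add: A_def flip: exp_add)
qed

text \<open>The columns of \<open>g\<close> are weight vectors, ordered such that the weights form an element of \<open>log_H\<close>.
The first column is rescaled to reach determinant one; this does not affect the conjugation, since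
diagonal matrices commute.\<close>

lemma SL2_hom_diagonal_conjugate_into_H:
  fixes \<Phi> :: "real^2^2 \<Rightarrow> real^5^5"
  assumes "lie_group_hom_SL \<Phi>"
  shows "\<exists>g. det g = 1 \<and> (\<forall>t. \<exists>A\<in>H. \<Phi> (mat2 (exp t) 0 0 (exp (- t))) ** g = g ** A)"
proof -
  obtain D where D: "differentiable_SL_hom \<Phi> D"
    using lie_group_hom_SL_differentiable[OF assms] by blast
  interpret sl2_triple_weyl "(*v) (D (mat2 0 1 0 0))" "(*v) (D (mat2 0 0 1 0))"
    "(*v) (D (mat2 1 0 0 (- 1)))" "(*v) (\<Phi> (mat2 0 1 (- 1) 0))"
    by (rule sl2_triple_weyl_of_SL2_hom[OF D])
  obtain bs w1 w2 w3 w4 w5 where bs: "length bs = 5" "independent (set bs)" "distinct bs"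
    "list_all2 (\<lambda>b w. D (mat2 1 0 0 (- 1)) *v b = of_int w *\<^sub>R b) bs [w1, w2, w3, w4, w5]"
    and w: "w1 + w2 + w3 + w4 + w5 = 0" "w3 + 2 * w4 + 3 * w5 = 0"
    using weight_basis_dim_5 by auto
  obtain b1 b2 b3 b4 b5 where b: "bs = [b1, b2, b3, b4, b5]"
    using bs(1) by (auto simp: numeral_eq_Suc length_Suc_conv)
  define v where "v = vec5 b1 b2 b3 b4 b5"
  define x :: "real^5" where "x = (\<chi> i. of_int (vec5 w1 w2 w3 w4 w5 i))"
  have x: "t *\<^sub>R x \<in> log_H" for t
  proof (rule subspace_scale[OF subspace_log_H])
    have "real_of_int (w1 + w2 + w3 + w4 + w5) = 0" "real_of_int (w3 + 2 * w4 + 3 * w5) = 0"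
      using w by simp_all
    then show "x \<in> log_H"
      by (simp add: log_H_def x_def sum_5)
  qed
  have eigen: "\<Phi> (mat2 (exp t) 0 0 (exp (- t))) *v v i = exp (t * x $ i) *\<^sub>R v i" for t i
  proof (rule SL2_hom_diagonal_eigenvector[OF D])
    have "\<forall>i. D (mat2 1 0 0 (- 1)) *v v i = x $ i *\<^sub>R v i"
      using bs(4) by (simp add: forall_5 v_def x_def b)
    then show "D (mat2 1 0 0 (- 1)) *v v i = x $ i *\<^sub>R v i" ..
  qed
  have inj: "inj v"
    using bs(3) exhaust_5 unfolding b inj_def v_def by (auto simp: vec5_def)
  have range: "range v = set bs"
    by (auto simp: b v_def UNIV_5)
  define g0 :: "real^5^5" where "g0 = (\<chi> i j. v j $ i)"
  have "\<exists>B. B ** g0 = mat 1"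
    unfolding matrix_left_invertible_independent_columns
  proof (intro allI impI)
    fix c i assume "(\<Sum>i\<in>UNIV. c i *s column i g0) = 0"
    moreover have "column i g0 = v i" for i
      by (simp add: column_def g0_def vec_eq_iff)
    ultimately have "(\<Sum>b\<in>set bs. c (inv_into UNIV v b) *\<^sub>R b) = 0"
      unfolding range[symmetric] by (subst sum.reindex[OF inj]) (simp add: inj scalar_mult_eq_scaleR)
    then have "c (inv_into UNIV v (v i)) = 0"
      using range by (intro independentD[OF bs(2) _ subset_refl]) auto
    then show "c i = 0"
      using inj by simp
  qed
  then have det: "det g0 \<noteq> 0"
    using invertible_det_nz invertible_left_inverse by blast
  define s :: "real^5" where "s = (\<chi> i. if i = 1 then 1 / det g0 else 1)"
  define g where "g = g0 ** diagonal s"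
  have "det g = 1"
    using det by (simp add: g_def det_mul det_diagonal prod_5 s_def)
  moreover have "\<Phi> (mat2 (exp t) 0 0 (exp (- t))) ** g = g ** diagonal (\<chi> i. exp ((t *\<^sub>R x) $ i))" for t
  proof -
    let ?A = "\<Phi> (mat2 (exp t) 0 0 (exp (- t)))" and ?d = "diagonal (\<chi> i. exp ((t *\<^sub>R x) $ i))"
    have "?A ** g0 = g0 ** ?d"
    proof (simp only: vec_eq_iff, intro allI)
      fix i j
      have "(?A ** g0) $ i $ j = (?A *v v j) $ i"
        by (simp add: matrix_matrix_mult_def matrix_vector_mult_def g0_def)
      then show "(?A ** g0) $ i $ j = (g0 ** ?d) $ i $ j"
        by (simp add: eigen matrix_mult_diagonal_nth g0_def)
    qed
    then have "?A ** g = g0 ** (?d ** diagonal s)"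
      by (simp add: g_def matrix_mul_assoc)
    also have "?d ** diagonal s = diagonal s ** ?d"
      by (simp add: diagonal_mult mult.commute)
    finally show ?thesis
      by (simp add: g_def matrix_mul_assoc)
  qed
  ultimately show ?thesis
    using x unfolding H_def by blast
qed

text \<open>The point \<open>gH\<close> is fixed by the image of \<open>diag(exp t, exp (-t))\<close> for every \<open>t\<close>, so the return set of a single
point is unbounded.\<close>

lemma SL2_action_not_proper:
  fixes \<Phi> :: "real^2^2 \<Rightarrow> real^5^5"
  assumes "lie_group_hom_SL \<Phi>"
  shows "\<not> proper_action SL_top (homogeneous_space H) (\<lambda>g. translate (\<Phi> g))"
proof
  assume proper: "proper_action SL_top (homogeneous_space H) (\<lambda>g. translate (\<Phi> g))"
  let ?a = "\<lambda>t. mat2 (exp t) 0 0 (exp (- t))"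
  obtain g where g: "det g = 1" and conj: "\<And>t. \<exists>A\<in>H. \<Phi> (?a t) ** g = g ** A"
    using SL2_hom_diagonal_conjugate_into_H[OF assms] by blast
  let ?C = "translate g H"
  have HS: "H \<subseteq> carrier SL"
    using subgroup_H subgroup.subset by blast
  have a: "?a t \<in> carrier SL" for t
    by (simp add: SL_def det_mat2 flip: exp_add)
  have gS: "g \<in> carrier SL"
    using g by (simp add: SL_def)
  have fixed: "translate (\<Phi> (?a t)) ?C = ?C" for t
  proof -
    obtain A where A: "A \<in> H" "\<Phi> (?a t) ** g = g ** A"
      using conj by blast
    have "\<Phi> (?a t) \<in> carrier SL"
      using assms a by (auto simp: lie_group_hom_SL_def hom_def)
    then have "translate (\<Phi> (?a t)) ?C = translate (g ** A) H"
      using translate_coset[OF _ gS HS] A(2) by (simp add: SL_def)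
    also have "\<dots> = translate g (translate A H)"
      using translate_coset[OF gS _ HS, of A] A(1) HS by (auto simp: SL_def)
    also have "translate A H = H"
      using A(1) HS by (intro group.coset_join3[OF group_SL _ subgroup_H]) auto
    finally show ?thesis .
  qed
  have "compactin (homogeneous_space H) {?C}"
    using gS by (simp add: topspace_homogeneous_space LCOSETS_def) blast
  then have "compactin SL_top {x \<in> topspace SL_top. translate (\<Phi> x) ` {?C} \<inter> {?C} \<noteq> {}}"
    using proper unfolding proper_action_def by blast
  then have "bounded {x \<in> carrier SL. translate (\<Phi> x) ` {?C} \<inter> {?C} \<noteq> {}}"
    by (simp add: compactin_subtopology compact_imp_bounded)
  then obtain B where B: "\<And>x. x \<in> carrier SL \<Longrightarrow> translate (\<Phi> x) ?C = ?C \<Longrightarrow> norm x \<le> B"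
    unfolding bounded_iff by (auto simp: eq_commute)
  have "exp t \<le> B" for t
  proof -
    have "exp t = \<bar>?a t $ 1 $ 1\<bar>" by simp
    also have "\<dots> \<le> norm (?a t)"
      using component_le_norm_cart order_trans Finite_Cartesian_Product.norm_nth_le by (metis norm_nth_le real_norm_def)
    also have "\<dots> \<le> B"
      using B[OF a fixed] .
    finally show ?thesis .
  qed
  from this[of B] show False
    using exp_ge_add_one_self[of B] by linarith
qed

section \<open>Ping-pong in SL(2)\<close>

text \<open>The hyperbolic matrices with eigenvalues \<open>m\<close> and \<open>1/m\<close> whose eigenlines are the coordinate axes
(\<open>i\<close> false) or the diagonals (\<open>i\<close> true).\<close>

definition hyperbolic :: "bool \<Rightarrow> real \<Rightarrow> real^2^2" where
  "hyperbolic i m = (if i then mat2 ((m + 1 / m) / 2) ((m - 1 / m) / 2) ((m - 1 / m) / 2) ((m + 1 / m) / 2)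
     else mat2 m 0 0 (1 / m))"

lemma hyperbolic_mult:
  "a \<noteq> 0 \<Longrightarrow> b \<noteq> 0 \<Longrightarrow> hyperbolic i a ** hyperbolic i b = hyperbolic i (a * b)"
  by (rule mat2_eqI; cases i; simp add: hyperbolic_def mat2_mult; simp add: field_simps)

lemma hyperbolic_1: "hyperbolic i 1 = mat 1"
  by (simp add: hyperbolic_def mat2_arith)

lemma hyperbolic_conjugate:
  "hyperbolic True m = mat2 1 (- 1) 1 1 ** hyperbolic False m ** mat2 (1 / 2) (1 / 2) (- 1 / 2) (1 / 2)"
  by (simp add: hyperbolic_def mat2_mult field_simps)

text \<open>The first component of a letter selects a generator, the second distinguishes it from its inverse.\<close>

type_synonym letter = "bool \<times> bool"

definition flip :: "letter \<Rightarrow> letter" where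
  "flip l = (fst l, \<not> snd l)"

lemma flip_flip [simp]: "flip (flip l) = l"
  by (simp add: flip_def)

definition exponent :: "real \<Rightarrow> letter \<Rightarrow> real" where
  "exponent m l = (if snd l then m else 1 / m)"

definition gen :: "real \<Rightarrow> letter \<Rightarrow> real^2^2" where
  "gen m l = hyperbolic (fst l) (exponent m l)"

definition word :: "real \<Rightarrow> letter list \<Rightarrow> real^2^2" where
  "word m ws = foldr (\<lambda>l A. gen m l ** A) ws (mat 1)"

lemma word_simps [simp]: "word m [] = mat 1" "word m (l # ws) = gen m l ** word m ws"
  by (simp_all add: word_def)

lemma gen_flip: "m \<noteq> 0 \<Longrightarrow> gen m l ** gen m (flip l) = mat 1"
  by (simp add: gen_def exponent_def flip_def hyperbolic_mult hyperbolic_1)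

lemma det_gen: "m \<noteq> 0 \<Longrightarrow> det (gen m l) = 1"
  by (simp add: gen_def exponent_def hyperbolic_def det_mat2 field_simps)

lemma det_word: "m \<noteq> 0 \<Longrightarrow> det (word m ws) = 1"
  by (induction ws) (simp_all add: det_mul det_gen)

definition sup_norm :: "real^2 \<Rightarrow> real" where
  "sup_norm v = max \<bar>v $ 1\<bar> \<bar>v $ 2\<bar>"

definition max_entry :: "real^2^2 \<Rightarrow> real" where
  "max_entry A = max (max \<bar>A $ 1 $ 1\<bar> \<bar>A $ 1 $ 2\<bar>) (max \<bar>A $ 2 $ 1\<bar> \<bar>A $ 2 $ 2\<bar>)"

lemma sup_norm_le_max_entry: "sup_norm (A *v v) \<le> 2 * max_entry A * sup_norm v"
proof -
  have "\<bar>(A *v v) $ i\<bar> \<le> 2 * max_entry A * sup_norm v" for i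
  proof -
    have "\<bar>(A *v v) $ i\<bar> \<le> \<bar>A $ i $ 1\<bar> * \<bar>v $ 1\<bar> + \<bar>A $ i $ 2\<bar> * \<bar>v $ 2\<bar>"
      by (simp add: matrix_vector_mult_def sum_2 abs_mult[symmetric] abs_triangle_ineq)
    also have "\<dots> \<le> max_entry A * sup_norm v + max_entry A * sup_norm v"
      using exhaust_2[of i] by (intro add_mono mult_mono) (auto simp: max_entry_def sup_norm_def le_max_iff_disj)
    finally show ?thesis by simp
  qed
  then show ?thesis
    by (simp add: sup_norm_def)
qed

lemma max_entry_le:
  assumes "\<And>v. sup_norm (A *v v) \<le> c * sup_norm v"
  shows "max_entry A \<le> c"
  using assms[of "axis 1 1"] assms[of "axis 2 1"]
  by (simp add: sup_norm_def max_entry_def matrix_vector_mult_def sum_2 axis_def)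

text \<open>The sector around the attracting eigenline of a letter, in coordinates \<open>p, q\<close> along its eigenlines.
With aperture \<open>1/3\<close> the four sectors meet only in the origin.\<close>

definition sector :: "letter \<Rightarrow> (real^2) set" where
  "sector l = {v. let p = if fst l then v $ 1 + v $ 2 else v $ 1;
                    q = if fst l then v $ 1 - v $ 2 else v $ 2
                in if snd l then 3 * \<bar>q\<bar> \<le> \<bar>p\<bar> else 3 * \<bar>p\<bar> \<le> \<bar>q\<bar>}"

lemma sectors_disjoint: "v \<in> sector l \<Longrightarrow> v \<in> sector l' \<Longrightarrow> l \<noteq> l' \<Longrightarrow> v = 0"
  by (cases l; cases l'; auto simp: sector_def Let_def vec_eq_iff forall_2 split: if_splits; smt (verit))

lemma hyperbolic_apply:
  "hyperbolic False m *v v = (\<chi> i. if i = 1 then m * v $ 1 else v $ 2 / m)"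
  "(hyperbolic True m *v v) $ 1 + (hyperbolic True m *v v) $ 2 = m * (v $ 1 + v $ 2)"
  "(hyperbolic True m *v v) $ 1 - (hyperbolic True m *v v) $ 2 = (v $ 1 - v $ 2) / m"
  by (simp_all add: hyperbolic_def vec_eq_iff forall_2 matrix_vector_mult_def sum_2 algebra_simps
      add_divide_distrib diff_divide_distrib)

lemma expand_coordinates:
  fixes p q m :: real
  assumes "m \<ge> 10" "\<not> 3 * \<bar>p\<bar> \<le> \<bar>q\<bar>"
  shows "3 * \<bar>q / m\<bar> \<le> \<bar>m * p\<bar>" "m * (\<bar>p\<bar> + \<bar>q\<bar>) \<le> 4 * \<bar>m * p\<bar>" 
proof -
  have "3 * \<bar>q\<bar> \<le> 10 * 10 * \<bar>p\<bar>" using assms(2) by linarith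
  also have "\<dots> \<le> m * m * \<bar>p\<bar>" using assms(1) by (intro mult_right_mono mult_mono) auto
  finally show "3 * \<bar>q / m\<bar> \<le> \<bar>m * p\<bar>" using assms(1) by (simp add: abs_mult field_simps)
  have "m * (\<bar>p\<bar> + \<bar>q\<bar>) \<le> m * (4 * \<bar>p\<bar>)" using assms by (intro mult_left_mono) auto
  then show "m * (\<bar>p\<bar> + \<bar>q\<bar>) \<le> 4 * \<bar>m * p\<bar>" using assms(1) by (simp add: abs_mult)
qed

text \<open>A vector off the repelling sector has a coordinate along the attracting line of at least a third
of the other one. That coordinate is multiplied by \<open>m\<close>; the factor \<open>1/4\<close> accounts for the
other coordinate and for the change to eigenline coordinates.\<close>

lemma ping_pong:
  assumes "m \<ge> 10" "v \<notin> sector (flip l)"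
  shows "gen m l *v v \<in> sector l" "m / 4 * sup_norm v \<le> sup_norm (gen m l *v v)"
proof -
  define u where "u = gen m l *v v"
  obtain i s where l: "l = (i, s)" by (cases l)
  define p q where "p = (if i then v $ 1 + v $ 2 else v $ 1)" and "q = (if i then v $ 1 - v $ 2 else v $ 2)"
  define p' q' where "p' = (if i then u $ 1 + u $ 2 else u $ 1)" and "q' = (if i then u $ 1 - u $ 2 else u $ 2)"
  have pq': "p' = exponent m l * p" "q' = q / exponent m l"
    by (cases i; simp add: p'_def q'_def p_def q_def u_def gen_def l hyperbolic_apply)+
  have "3 * \<bar>q'\<bar> \<le> \<bar>p'\<bar> \<and> m * (\<bar>p\<bar> + \<bar>q\<bar>) \<le> 4 * \<bar>p'\<bar>" if s
    using expand_coordinates[OF assms(1), of p q] assms(2) that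
    by (simp add: pq' exponent_def l sector_def flip_def p_def q_def Let_def)
  moreover have "3 * \<bar>p'\<bar> \<le> \<bar>q'\<bar> \<and> m * (\<bar>q\<bar> + \<bar>p\<bar>) \<le> 4 * \<bar>q'\<bar>" if "\<not> s"
    using expand_coordinates[OF assms(1), of q p] assms(2) that
    by (simp add: pq' exponent_def l sector_def flip_def p_def q_def Let_def mult.commute)
  moreover have "u \<in> sector l \<longleftrightarrow> (if s then 3 * \<bar>q'\<bar> \<le> \<bar>p'\<bar> else 3 * \<bar>p'\<bar> \<le> \<bar>q'\<bar>)"
    by (cases i; simp add: sector_def l p'_def q'_def Let_def)
  ultimately have *: "u \<in> sector l" "m * (\<bar>p\<bar> + \<bar>q\<bar>) \<le> 4 * max \<bar>p'\<bar> \<bar>q'\<bar>"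
    by (cases s; simp add: add.commute; linarith)+
  then show "gen m l *v v \<in> sector l" by (simp add: u_def)
  show "m / 4 * sup_norm v \<le> sup_norm (gen m l *v v)"
  proof (cases i)
    case False
    have "m * sup_norm v \<le> m * (\<bar>p\<bar> + \<bar>q\<bar>)"
      using assms(1) False by (intro mult_left_mono) (auto simp: p_def q_def sup_norm_def)
    moreover have "max \<bar>p'\<bar> \<bar>q'\<bar> = sup_norm u"
      using False by (simp add: p'_def q'_def sup_norm_def)
    ultimately show ?thesis
      using *(2) by (simp add: u_def)
  next
    case True
    have "2 * \<bar>v $ 1\<bar> \<le> \<bar>p\<bar> + \<bar>q\<bar>" "2 * \<bar>v $ 2\<bar> \<le> \<bar>p\<bar> + \<bar>q\<bar>"
      using True unfolding p_def q_def by (simp; linarith)+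
    then have "2 * sup_norm v \<le> \<bar>p\<bar> + \<bar>q\<bar>"
      by (simp add: sup_norm_def max_def)
    then have "m * (2 * sup_norm v) \<le> m * (\<bar>p\<bar> + \<bar>q\<bar>)"
      using assms(1) by (intro mult_left_mono) auto
    moreover have "\<bar>u $ 1\<bar> \<le> sup_norm u" "\<bar>u $ 2\<bar> \<le> sup_norm u"
      by (simp_all add: sup_norm_def)
    then have "\<bar>p'\<bar> \<le> 2 * sup_norm u" "\<bar>q'\<bar> \<le> 2 * sup_norm u"
      using True unfolding p'_def q'_def by (simp; linarith)+
    then have "max \<bar>p'\<bar> \<bar>q'\<bar> \<le> 2 * sup_norm u"
      by simp
    ultimately have "m * (2 * sup_norm v) \<le> 8 * sup_norm u"
      using *(2) by linarith
    then show ?thesis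
      by (simp add: u_def)
  qed
qed

lemma sup_norm_gen_le:
  assumes "m \<ge> 1"
  shows "sup_norm (gen m l *v v) \<le> m * sup_norm v"
proof -
  define c where "c = exponent m l"
  have c: "c > 0" "c \<le> m" "1 / c \<le> m"
    using assms order_trans[of "1 / m" 1 m] by (auto simp: c_def exponent_def)
  show ?thesis
  proof (cases "fst l")
    case False
    have "c * \<bar>v $ 1\<bar> \<le> m * sup_norm v" "1 / c * \<bar>v $ 2\<bar> \<le> m * sup_norm v"
      using c assms by (intro mult_mono; simp add: sup_norm_def)+
    then show ?thesis
      using False c(1) by (simp add: gen_def c_def[symmetric] hyperbolic_apply sup_norm_def abs_mult)
  next
    case True
    define u where "u = gen m l *v v"
    have "\<bar>u $ 1 + u $ 2\<bar> = c * \<bar>v $ 1 + v $ 2\<bar>" "\<bar>u $ 1 - u $ 2\<bar> = 1 / c * \<bar>v $ 1 - v $ 2\<bar>"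
      using True c(1) by (simp_all add: u_def gen_def c_def[symmetric] hyperbolic_apply abs_mult)
    moreover have "c * \<bar>v $ 1 + v $ 2\<bar> \<le> m * \<bar>v $ 1 + v $ 2\<bar>" "1 / c * \<bar>v $ 1 - v $ 2\<bar> \<le> m * \<bar>v $ 1 - v $ 2\<bar>"
      using c by (intro mult_right_mono; simp)+
    moreover have "2 * sup_norm u = \<bar>u $ 1 + u $ 2\<bar> + \<bar>u $ 1 - u $ 2\<bar>" for u
      by (auto simp: sup_norm_def)
    ultimately show ?thesis
      unfolding u_def[symmetric] by (smt (verit) distrib_left mult.left_commute)
  qed
qed

lemma max_entry_word_le:
  assumes "m \<ge> 1"
  shows "max_entry (word m ws) \<le> m ^ length ws"
proof (rule max_entry_le)
  fix v show "sup_norm (word m ws *v v) \<le> m ^ length ws * sup_norm v"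
  proof (induction ws)
    case (Cons l ws)
    have "sup_norm (word m (l # ws) *v v) \<le> m * sup_norm (word m ws *v v)"
      using sup_norm_gen_le[OF assms] by (simp flip: matrix_vector_mul_assoc)
    also have "\<dots> \<le> m * (m ^ length ws * sup_norm v)"
      using assms Cons.IH by (intro mult_left_mono) auto
    finally show ?case by (simp add: mult_ac)
  qed simp
qed

definition reduced :: "letter list \<Rightarrow> bool" where
  "reduced = successively (\<lambda>l l'. l' \<noteq> flip l)"

text \<open>Each letter of a reduced word meets a vector outside its repelling sector, because that vector lies
in the attracting sector of the next letter, and so expands it by the factor \<open>m/4\<close>.\<close>

lemma max_entry_reduced_word_ge:
  assumes m: "m \<ge> 10" and "reduced ws"
  shows "(m / 4) ^ length ws \<le> 2 * max_entry (word m ws)"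
proof -
  \<comment> \<open>A vector outside all four sectors, to start the induction.\<close>
  define v :: "real^2" where "v = (\<chi> i. if i = 1 then 5 else 2)"
  have v: "v \<notin> sector l" for l
    by (cases l) (simp add: sector_def v_def Let_def)
  have "(m / 4) ^ length ws * sup_norm v \<le> sup_norm (word m ws *v v) \<and>
      (ws \<noteq> [] \<longrightarrow> word m ws *v v \<in> sector (hd ws))"
    using assms(2)
  proof (induction ws)
    case Nil
    then show ?case by simp
  next
    case (Cons l ws)
    have red: "reduced ws" "ws \<noteq> [] \<Longrightarrow> hd ws \<noteq> flip l"
      using Cons.prems by (auto simp: reduced_def successively_Cons)
    let ?u = "word m ws *v v"
    have IH: "(m / 4) ^ length ws * sup_norm v \<le> sup_norm ?u" "ws \<noteq> [] \<Longrightarrow> ?u \<in> sector (hd ws)"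
      using Cons.IH[OF red(1)] by auto
    have "?u \<noteq> 0"
    proof
      assume "?u = 0"
      then have "(m / 4) ^ length ws * sup_norm v \<le> 0"
        using IH(1) by (simp add: sup_norm_def)
      moreover have "(m / 4) ^ length ws * sup_norm v > 0"
        using m by (simp add: v_def sup_norm_def)
      ultimately show False by simp
    qed
    then have "?u \<notin> sector (flip l)"
      using IH(2) red(2) v sectors_disjoint[of ?u "hd ws" "flip l"] by (cases "ws = []") auto
    note pp = ping_pong[OF m this]
    have "(m / 4) ^ length (l # ws) * sup_norm v \<le> m / 4 * sup_norm ?u"
      using m IH(1) by (simp add: mult.assoc)
    then show ?case
      using pp by (simp add: matrix_vector_mul_assoc)
  qed
  then have "(m / 4) ^ length ws * sup_norm v \<le> 2 * max_entry (word m ws) * sup_norm v"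
    using sup_norm_le_max_entry order_trans by blast
  then show ?thesis
    by (simp add: v_def sup_norm_def)
qed

section \<open>Pivoted decompositions\<close>

lemma max_entry_mat2: "max_entry (mat2 a b c d) = max (max \<bar>a\<bar> \<bar>b\<bar>) (max \<bar>c\<bar> \<bar>d\<bar>)"
  by (simp add: max_entry_def)

text \<open>Gaussian elimination with an entry of maximal absolute value as pivot. It replaces the singular
value decomposition: \<open>L\<close>, \<open>U\<close> and the inverse \<open>U'\<close> of \<open>U\<close> stay bounded, and the diagonal factor
has the size of the pivot and of its inverse.\<close>

lemma pivot_decomposition:
  fixes A :: "real^2^2"
  assumes det: "det A = 1"
  shows "\<exists>L U U' a b. L ** A = mat2 a 0 0 b ** U \<and> U ** U' = mat 1 \<and>
    max_entry L \<le> 1 \<and> max_entry U \<le> 1 \<and> max_entry U' \<le> 1 \<and>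
    \<bar>a\<bar> = max_entry A \<and> \<bar>b\<bar> = 1 / max_entry A \<and> max_entry A > 0"
proof -
  define p q r s where pqrs: "p = A $ 1 $ 1" "q = A $ 1 $ 2" "r = A $ 2 $ 1" "s = A $ 2 $ 2"
  have A: "A = mat2 p q r s"
    by (rule mat2_eqI) (simp_all add: pqrs)
  have d: "p * s - q * r = 1"
    using det by (simp add: A det_mat2)
  let ?m = "max_entry A"
  have pos: "?m > 0"
    using d by (auto simp: A max_entry_def less_max_iff_disj)
  have le: "\<bar>p\<bar> \<le> ?m" "\<bar>q\<bar> \<le> ?m" "\<bar>r\<bar> \<le> ?m" "\<bar>s\<bar> \<le> ?m"
    by (simp_all add: A max_entry_def le_max_iff_disj)
  have quot: "\<bar>x / y\<bar> \<le> 1" if "\<bar>x\<bar> \<le> ?m" "\<bar>y\<bar> = ?m" for x y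
    using that pos by (simp add: divide_le_eq)
  consider "\<bar>p\<bar> = ?m" | "\<bar>q\<bar> = ?m" | "\<bar>r\<bar> = ?m" | "\<bar>s\<bar> = ?m"
    unfolding A max_entry_def mat2_nth by (smt (verit) max_def)
  moreover have witness: ?thesis
    if "L ** A = mat2 a 0 0 b ** U" "U ** U' = mat 1" "max_entry L \<le> 1" "max_entry U \<le> 1"
      "max_entry U' \<le> 1" "\<bar>a\<bar> = ?m" "\<bar>b\<bar> = 1 / ?m" for L U U' a b
    using that pos by blast
  ultimately show ?thesis
  proof cases
    case 1
    then have p: "p \<noteq> 0" using pos by auto
    have "mat2 1 0 (- (r / p)) 1 ** A = mat2 p 0 0 (1 / p) ** mat2 1 (q / p) 0 1"
      using p d by (intro mat2_eqI; simp add: A mat2_mult; simp add: field_simps)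
    moreover have "mat2 1 (q / p) 0 1 ** mat2 1 (- (q / p)) 0 1 = mat 1"
      by (simp add: mat2_mult mat2_arith)
    ultimately show ?thesis
      by (rule witness) (use 1 quot[OF le(2) 1] quot[OF le(3) 1] in \<open>simp_all add: max_entry_mat2\<close>)
  next
    case 2
    then have q: "q \<noteq> 0" using pos by auto
    have "mat2 1 0 (- (s / q)) 1 ** A = mat2 q 0 0 (- (1 / q)) ** mat2 (p / q) 1 1 0"
      using q d by (intro mat2_eqI; simp add: A mat2_mult; simp add: field_simps)
    moreover have "mat2 (p / q) 1 1 0 ** mat2 0 1 1 (- (p / q)) = mat 1"
      by (simp add: mat2_mult mat2_arith)
    ultimately show ?thesis
      by (rule witness) (use 2 quot[OF le(1) 2] quot[OF le(4) 2] in \<open>simp_all add: max_entry_mat2\<close>)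
  next
    case 3
    then have r: "r \<noteq> 0" using pos by auto
    have "mat2 0 1 1 (- (p / r)) ** A = mat2 r 0 0 (- (1 / r)) ** mat2 1 (s / r) 0 1"
      using r d by (intro mat2_eqI; simp add: A mat2_mult; simp add: field_simps)
    moreover have "mat2 1 (s / r) 0 1 ** mat2 1 (- (s / r)) 0 1 = mat 1"
      by (simp add: mat2_mult mat2_arith)
    ultimately show ?thesis
      by (rule witness) (use 3 quot[OF le(1) 3] quot[OF le(4) 3] in \<open>simp_all add: max_entry_mat2\<close>)
  next
    case 4
    then have s: "s \<noteq> 0" using pos by auto
    have "mat2 0 1 1 (- (q / s)) ** A = mat2 s 0 0 (1 / s) ** mat2 (r / s) 1 1 0"
      using s d by (intro mat2_eqI; simp add: A mat2_mult; simp add: field_simps)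
    moreover have "mat2 (r / s) 1 1 0 ** mat2 0 1 1 (- (r / s)) = mat 1"
      by (simp add: mat2_mult mat2_arith)
    ultimately show ?thesis
      by (rule witness) (use 4 quot[OF le(2) 4] quot[OF le(3) 4] in \<open>simp_all add: max_entry_mat2\<close>)
  qed
qed
section \<open>Block matrices\<close>

definition block :: "real^2^2 \<Rightarrow> real^2^2 \<Rightarrow> real^5^5" where
  "block A B = (\<chi> i j. vec5
     (vec5 (A $ 1 $ 1) (A $ 1 $ 2) 0 0 0 j)
     (vec5 (A $ 2 $ 1) (A $ 2 $ 2) 0 0 0 j)
     (vec5 0 0 (B $ 1 $ 1) (B $ 1 $ 2) 0 j)
     (vec5 0 0 (B $ 2 $ 1) (B $ 2 $ 2) 0 j)
     (vec5 0 0 0 0 1 j) i)"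

lemma block_mult: "block A B ** block C D = block (A ** C) (B ** D)"
  by (simp add: vec_eq_iff forall_5 block_def matrix_matrix_mult_def sum_5 sum_2)

lemma block_1: "block (mat 1) (mat 1) = mat 1"
  by (simp add: vec_eq_iff forall_5 block_def mat_def)

lemma block_diagonal:
  "block (mat2 a 0 0 b) (mat2 c 0 0 d) = diagonal (\<chi> i. vec5 a b c d 1 i)"
  by (simp add: vec_eq_iff forall_5 block_def)

lemma block_eq_iff: "block A B = block C D \<longleftrightarrow> A = C \<and> B = D"
  by (simp add: vec_eq_iff forall_5 forall_2 block_def)

lemma block_entry_le:
  assumes "max_entry A \<le> 1" "max_entry B \<le> 1"
  shows "\<bar>block A B $ i $ j\<bar> \<le> 1"
proof -
  have "\<forall>i j. \<bar>block A B $ i $ j\<bar> \<le> 1"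
    using assms by (simp add: forall_5 block_def max_entry_def)
  then show ?thesis by blast
qed

section \<open>Comparison of diagonal factors\<close>

text \<open>In the Leibniz formula the largest summand is at least the average.\<close>

lemma det_le_permutation_product:
  fixes A :: "real^'n^'n"
  shows "\<exists>p. p permutes UNIV \<and> \<bar>det A\<bar> \<le> fact CARD('n) * (\<Prod>i\<in>UNIV. \<bar>A $ i $ p i\<bar>)"
proof -
  let ?P = "{p. p permutes (UNIV :: 'n set)}"
  let ?f = "\<lambda>p. \<Prod>i\<in>UNIV. \<bar>A $ i $ p i\<bar>"
  have fin: "finite ?P" and ne: "?P \<noteq> {}"
    using permutes_id[of "UNIV :: 'n set"] by (blast intro: finite_permutations finite)+
  have "Max (?f ` ?P) \<in> ?f ` ?P"
    using fin ne by (intro Max_in) auto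
  then obtain p where p: "p \<in> ?P" "?f p = Max (?f ` ?P)"
    by auto
  have max: "?f q \<le> ?f p" if "q \<in> ?P" for q
    unfolding p(2) using fin that by (intro Max_ge) auto
  have "\<bar>det A\<bar> \<le> (\<Sum>q\<in>?P. \<bar>of_int (sign q) * (\<Prod>i\<in>UNIV. A $ i $ q i)\<bar>)"
    unfolding det_def by (rule sum_abs)
  also have "\<dots> = (\<Sum>q\<in>?P. ?f q)"
    by (intro sum.cong refl) (simp add: abs_mult abs_prod sign_def)
  also have "\<dots> \<le> (\<Sum>q\<in>?P. ?f p)"
    using max by (intro sum_mono) blast
  also have "\<dots> = fact CARD('n) * ?f p"
    by (simp add: card_permutations)
  finally show ?thesis
    using p(1) by blast
qed

lemma det_bound:
  fixes A :: "real^'n^'n"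
  assumes "\<And>i j. \<bar>A $ i $ j\<bar> \<le> R"
  shows "\<bar>det A\<bar> \<le> fact CARD('n) * R ^ CARD('n)"
proof -
  obtain p where "\<bar>det A\<bar> \<le> fact CARD('n) * (\<Prod>i\<in>UNIV. \<bar>A $ i $ p i\<bar>)"
    using det_le_permutation_product by blast
  also have "\<dots> \<le> fact CARD('n) * (\<Prod>i\<in>(UNIV::'n set). R)"
    using assms by (intro mult_left_mono prod_mono) auto
  finally show ?thesis by simp
qed

text \<open>If a matrix is bounded and its determinant is not small, then there is a permutation along which
no entry is small.\<close>

lemma det_permutation_lower_bound:
  fixes A :: "real^'n^'n"
  assumes R: "\<And>i j. \<bar>A $ i $ j\<bar> \<le> R"
  shows "\<exists>p. p permutes UNIV \<and>
    (\<forall>i. \<bar>det A\<bar> \<le> fact CARD('n) * R ^ (CARD('n) - 1) * \<bar>A $ i $ p i\<bar>)"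
proof -
  obtain p where p: "p permutes UNIV"
    "\<bar>det A\<bar> \<le> fact CARD('n) * (\<Prod>i\<in>UNIV. \<bar>A $ i $ p i\<bar>)"
    using det_le_permutation_product by blast
  have "\<bar>det A\<bar> \<le> fact CARD('n) * R ^ (CARD('n) - 1) * \<bar>A $ i $ p i\<bar>" for i
  proof -
    have "(\<Prod>i\<in>UNIV. \<bar>A $ i $ p i\<bar>) = \<bar>A $ i $ p i\<bar> * (\<Prod>j\<in>UNIV - {i}. \<bar>A $ j $ p j\<bar>)"
      by (rule prod.remove) auto
    also have "\<dots> \<le> \<bar>A $ i $ p i\<bar> * (\<Prod>j\<in>UNIV - {i}. R)"
      using R by (intro mult_left_mono prod_mono) auto
    also have "\<dots> = R ^ (CARD('n) - 1) * \<bar>A $ i $ p i\<bar>"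
      by (simp add: card_Diff_singleton)
    finally have "fact CARD('n) * (\<Prod>i\<in>UNIV. \<bar>A $ i $ p i\<bar>)
        \<le> fact CARD('n) * (R ^ (CARD('n) - 1) * \<bar>A $ i $ p i\<bar>)"
      by (rule mult_left_mono) simp
    from order_trans[OF p(2) this] show ?thesis by (simp only: mult.assoc)
  qed
  with p(1) show ?thesis by blast
qed

lemma matrix_mult_entry_le:
  fixes A :: "real^'n^'m" and B :: "real^'p^'n" and R :: real
  assumes "\<And>i j. \<bar>A $ i $ j\<bar> \<le> 1" "\<And>i j. \<bar>B $ i $ j\<bar> \<le> R"
  shows "\<bar>(A ** B) $ i $ j\<bar> \<le> CARD('n) * R"
proof -
  have "\<bar>(A ** B) $ i $ j\<bar> \<le> (\<Sum>k\<in>UNIV. \<bar>A $ i $ k * B $ k $ j\<bar>)"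
    unfolding matrix_matrix_mult_def by (simp add: sum_abs)
  also have "\<dots> \<le> (\<Sum>k\<in>(UNIV::'n set). 1 * R)"
    unfolding abs_mult using assms by (intro sum_mono mult_mono) auto
  finally show ?thesis by simp
qed

text \<open>Entrywise the equation reads \<open>a i * q i j = p i j * exp (x j)\<close>. Along a permutation \<open>s\<close> for which
the entries \<open>q i (s i)\<close> are not small, this bounds \<open>exp (x (s i))\<close> from below by a multiple of
\<open>\<bar>a i\<bar>\<close>. The upper
bounds follow from the lower ones because both families of logarithms have sum zero.\<close>

lemma diagonal_comparison:
  fixes e x :: "real^'n" and p q :: "real^'n^'n"
  assumes eq: "diagonal a ** q = p ** diagonal (\<chi> i. exp (x $ i))"
    and a: "\<And>i. \<bar>a $ i\<bar> = exp (e $ i)"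
    and q: "\<And>i j. \<bar>q $ i $ j\<bar> \<le> R" and p: "\<And>i j. \<bar>p $ i $ j\<bar> \<le> R"
    and det: "\<bar>det q\<bar> \<ge> d" "d > 0"
    and sum: "(\<Sum>i\<in>UNIV. e $ i) = 0" "(\<Sum>i\<in>UNIV. x $ i) = 0"
  shows "\<exists>s. s permutes UNIV \<and>
    (\<forall>i. \<bar>x $ s i - e $ i\<bar> \<le> CARD('n) * \<bar>ln (fact CARD('n) * R ^ CARD('n) / d)\<bar>)"
proof -
  let ?C = "ln (fact CARD('n) * R ^ CARD('n) / d)"
  let ?n = "CARD('n)"
  obtain s where s: "s permutes UNIV"
    "\<And>i. \<bar>det q\<bar> \<le> fact ?n * R ^ (?n - 1) * \<bar>q $ i $ s i\<bar>"
    using det_permutation_lower_bound[OF q] by blast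
  have R: "R > 0"
  proof (rule ccontr)
    assume "\<not> R > 0"
    then have "\<bar>q $ i $ j\<bar> \<le> 0" for i j
      using q[of i j] by linarith
    then have "\<bar>det q\<bar> \<le> 0"
      using s(2) by simp
    then show False using det by linarith
  qed
  have lower: "e $ i - ?C \<le> x $ s i" for i
  proof -
    have "exp (e $ i) * \<bar>q $ i $ s i\<bar> = \<bar>(diagonal a ** q) $ i $ s i\<bar>"
      by (simp add: diagonal_matrix_mult_nth abs_mult a)
    also have "\<dots> = \<bar>p $ i $ s i\<bar> * exp (x $ s i)"
      by (simp add: eq matrix_mult_diagonal_nth abs_mult)
    also have "\<dots> \<le> R * exp (x $ s i)"
      using p by (intro mult_right_mono) auto
    finally have 1: "exp (e $ i) * \<bar>q $ i $ s i\<bar> \<le> R * exp (x $ s i)" .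
    have "d * exp (e $ i) \<le> (fact ?n * R ^ (?n - 1) * \<bar>q $ i $ s i\<bar>) * exp (e $ i)"
      using det(1) s(2)[of i] by (intro mult_right_mono) auto
    also have "\<dots> = fact ?n * R ^ (?n - 1) * (exp (e $ i) * \<bar>q $ i $ s i\<bar>)"
      by simp
    also have "\<dots> \<le> fact ?n * R ^ (?n - 1) * (R * exp (x $ s i))"
      using 1 R by (intro mult_left_mono) auto
    also have "\<dots> = fact ?n * R ^ ?n * exp (x $ s i)"
      by (simp add: power_eq_if[of R ?n])
    finally have "exp (e $ i) \<le> (fact ?n * R ^ ?n / d) * exp (x $ s i)"
      using det(2) by (simp add: field_simps)
    also have "\<dots> = exp (?C + x $ s i)"
      using det(2) R by (simp add: exp_add)
    finally show ?thesis by simp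
  qed
  have "(\<Sum>i\<in>UNIV. x $ s i - e $ i) = 0"
    using sum sum.permute[OF s(1), of "\<lambda>i. x $ i"] by (simp add: sum_subtractf o_def)
  moreover have "(\<Sum>j\<in>UNIV. x $ s j - e $ j) = (x $ s i - e $ i) + (\<Sum>j\<in>UNIV - {i}. x $ s j - e $ j)" for i
    by (rule sum.remove) auto
  moreover have "(\<Sum>j\<in>UNIV - {i}. x $ s j - e $ j) \<ge> (\<Sum>j\<in>UNIV - {i}. - \<bar>?C\<bar>)" for i
    using lower by (intro sum_mono) (smt (verit))
  moreover have "(\<Sum>j\<in>UNIV - {i::'n}. - \<bar>?C\<bar>) \<ge> - (?n * \<bar>?C\<bar>)" for i
    by (simp add: card_Diff_singleton mult_right_mono)
  ultimately have upper: "x $ s i - e $ i \<le> ?n * \<bar>?C\<bar>" for i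
    by (smt (verit))
  have "1 * \<bar>?C\<bar> \<le> ?n * \<bar>?C\<bar>"
    by (intro mult_right_mono) (auto simp: Suc_leI)
  then have "\<bar>x $ s i - e $ i\<bar> \<le> ?n * \<bar>?C\<bar>" for i
    using lower[of i] upper[of i] by linarith
  then show ?thesis
    using s(1) by blast
qed

section \<open>A discrete group generated by hyperbolic blocks\<close>

text \<open>With the eigenvalues 10000 and 10, the ping-pong lower bound \<open>(10000/4)\<^sup>n\<close> for the first block exceeds
the third power of the upper bound \<open>10\<^sup>n\<close> for the second one by the factor \<open>(5/2)\<^sup>n\<close>, and \<open>(5/2)\<^sup>n\<close>
is also the ping-pong lower bound for the second block.\<close>

definition Gamma :: "(real^5^5) set" where
  "Gamma = range (\<lambda>ws. block (word 10000 ws) (word 10 ws))"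

lemma word_append: "word m (us @ vs) = word m us ** word m vs"
  by (induction us) (simp_all add: matrix_mul_assoc)

lemma word_inverse: "m \<noteq> 0 \<Longrightarrow> word m (rev (map flip ws)) ** word m ws = mat 1"
proof (induction ws)
  case (Cons l ws)
  have "gen m (flip l) ** gen m l = mat 1"
    using gen_flip[OF Cons.prems, of "flip l"] by simp
  then have "word m (rev (map flip (l # ws))) ** word m (l # ws) = word m (rev (map flip ws)) ** word m ws"
    by (simp add: word_append) (metis matrix_mul_assoc matrix_mul_lid)
  then show ?case
    using Cons by simp
qed simp

text \<open>Cancelling adjacent inverse letters does not depend on \<open>m\<close>, so one reduced word serves both blocks.\<close>

lemma reduced_word_exists:
  "\<exists>vs. reduced vs \<and> (\<forall>m. m \<noteq> 0 \<longrightarrow> word m vs = word m ws)"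
proof (induction ws)
  case Nil
  then show ?case by (intro exI[of _ "[]"]) (simp add: reduced_def)
next
  case (Cons l ws)
  then obtain vs where vs: "reduced vs" "\<And>m. m \<noteq> 0 \<Longrightarrow> word m vs = word m ws"
    by blast
  show ?case
  proof (cases "vs \<noteq> [] \<and> hd vs = flip l")
    case True
    then obtain us where us: "vs = flip l # us"
      by (cases vs) auto
    have "word m us = word m (l # ws)" if "m \<noteq> 0" for m
      using vs(2)[OF that] gen_flip[OF that, of l] unfolding us
      by (metis matrix_mul_assoc matrix_mul_lid word_simps(2))
    moreover have "reduced us"
      using vs(1) us by (auto simp: reduced_def successively_Cons)
    ultimately show ?thesis by blast
  next
    case False
    then have "reduced (l # vs)"
      using vs(1) by (auto simp: reduced_def successively_Cons)
    then show ?thesis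
      using vs(2) by (intro exI[of _ "l # vs"]) simp
  qed
qed

text \<open>Conjugation by a block matrix reduces the second generator to a diagonal matrix.\<close>

lemma det_block_gen:
  assumes "a \<noteq> 0" "b \<noteq> 0"
  shows "det (block (gen a l) (gen b l)) = 1"
proof -
  have diag: "det (block (hyperbolic False c) (hyperbolic False d)) = 1" if "c \<noteq> 0" "d \<noteq> 0" for c d
    using that by (simp add: hyperbolic_def block_diagonal det_diagonal prod_5)
  let ?R = "mat2 1 (- 1) 1 1" and ?R' = "mat2 (1 / 2) (1 / 2) (- 1 / 2) (1 / 2)"
  have "?R ** ?R' = mat 1"
    by (simp add: mat2_mult mat2_arith)
  then have "det (block ?R ?R) * det (block ?R' ?R') = 1"
    by (simp add: block_mult block_1 flip: det_mul)
  moreover have "det (block (hyperbolic True c) (hyperbolic True d)) =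
      det (block ?R ?R) * det (block (hyperbolic False c) (hyperbolic False d)) * det (block ?R' ?R')" for c d
    by (simp add: hyperbolic_conjugate block_mult flip: det_mul)
  ultimately have "det (block (hyperbolic True c) (hyperbolic True d)) = 1" if "c \<noteq> 0" "d \<noteq> 0" for c d
    using diag[OF that] by simp
  then show ?thesis
    using diag assms by (cases "fst l") (simp_all add: gen_def exponent_def)
qed

lemma det_Gamma: "A \<in> Gamma \<Longrightarrow> det A = 1"
proof -
  have "det (block (word 10000 ws) (word 10 ws)) = 1" for ws
  proof (induction ws)
    case (Cons l ws)
    then show ?case
      using det_block_gen[of 10000 10 l] by (simp add: det_mul flip: block_mult)
  qed (simp add: block_1)
  then show "A \<in> Gamma \<Longrightarrow> det A = 1"
    by (auto simp: Gamma_def)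
qed

lemma subgroup_Gamma: "subgroup Gamma SL"
proof (rule group.subgroupI[OF group_SL])
  show "Gamma \<subseteq> carrier SL"
    using det_Gamma by (auto simp: SL_def)
  show "Gamma \<noteq> {}"
    by (simp add: Gamma_def)
next
  fix A B assume "A \<in> Gamma" "B \<in> Gamma"
  then show "A \<otimes>\<^bsub>SL\<^esub> B \<in> Gamma"
    by (auto simp: Gamma_def SL_def block_mult simp flip: word_append)
next
  fix A assume A: "A \<in> Gamma"
  then obtain ws where ws: "A = block (word 10000 ws) (word 10 ws)"
    by (auto simp: Gamma_def)
  let ?B = "block (word 10000 (rev (map flip ws))) (word 10 (rev (map flip ws)))"
  have B: "?B \<in> Gamma"
    by (auto simp: Gamma_def)
  have "?B ** A = mat 1"
    by (simp add: ws block_mult word_inverse block_1)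
  then have "inv\<^bsub>SL\<^esub> A = ?B"
    using A B det_Gamma by (intro group.inv_equality[OF group_SL]) (auto simp: SL_def)
  then show "inv\<^bsub>SL\<^esub> A \<in> Gamma"
    using B by simp
qed

text \<open>The form with coefficients \<open>0, 0, 1, 2, 3\<close>, evaluated on a permutation of \<open>(a, -a, b, -b, 0)\<close>, is
\<open>a d\<^sub>1 + b d\<^sub>2\<close>, where \<open>d\<^sub>1\<close> and \<open>d\<^sub>2\<close> are differences of coefficients at disjoint pairs of indices. If
\<open>d\<^sub>1 = 0\<close>, the first pair uses up the two equal coefficients and \<open>\<bar>d\<^sub>2\<bar> \<ge> 1\<close>; otherwise \<open>\<bar>d\<^sub>1\<bar> \<ge> 1\<close>
and \<open>\<bar>d\<^sub>2\<bar> \<le> 3\<close>.\<close>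

lemma root_form_avoids_log_H:
  fixes a b K :: real
  assumes s: "inj s" and ab: "a \<ge> 0" "b \<ge> 0"
    and K: "\<bar>\<Sum>i\<in>UNIV. vec5 0 0 1 2 3 (s i) * vec5 a (- a) b (- b) 0 i\<bar> \<le> K"
  shows "b \<le> K \<or> a - 3 * b \<le> K"
proof -
  let ?f = "vec5 0 0 1 2 3 :: 5 \<Rightarrow> real"
  define d1 d2 where "d1 = ?f (s 1) - ?f (s 2)" and "d2 = ?f (s 3) - ?f (s 4)"
  have K': "\<bar>a * d1 + b * d2\<bar> \<le> K"
    using K by (simp add: sum_5 d1_def d2_def algebra_simps)
  have vals: "?f i \<in> {0, 1, 2, 3}" for i
    using exhaust_5[of i] by auto
  have eq: "i \<in> {1, 2} \<and> j \<in> {1, 2}" if "?f i = ?f j" "i \<noteq> j" for i j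
    using that exhaust_5[of i] exhaust_5[of j] by auto
  have int: "x = y \<or> \<bar>x - y\<bar> \<ge> 1" "\<bar>x - y\<bar> \<le> 3" if "x \<in> {0, 1, 2, 3}" "y \<in> {0, 1, 2, 3}" for x y :: real
    using that by auto
  have ne: "s i \<noteq> s j" if "i \<noteq> j" for i j
    using s that by (auto dest: injD)
  show ?thesis
  proof (cases "d1 = 0")
    case True
    then have "s 1 \<in> {1, 2}" "s 2 \<in> {1, 2}"
      using eq[of "s 1" "s 2"] ne[of 1 2] by (auto simp: d1_def)
    then have "s 3 \<notin> {1, 2}" "s 4 \<notin> {1, 2}"
      using ne[of 1 2] ne[of 1 3] ne[of 2 3] ne[of 1 4] ne[of 2 4] by auto
    then have "d2 \<noteq> 0"
      using eq[of "s 3" "s 4"] ne[of 3 4] by (auto simp: d2_def)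
    then have "1 \<le> \<bar>d2\<bar>"
      using int(1)[OF vals vals, of "s 3" "s 4"] by (auto simp: d2_def)
    then have "b * 1 \<le> b * \<bar>d2\<bar>"
      using ab by (intro mult_left_mono) auto
    then show ?thesis
      using K' True ab by (simp add: abs_mult)
  next
    case False
    then have "1 \<le> \<bar>d1\<bar>"
      using int(1)[OF vals vals, of "s 1" "s 2"] by (auto simp: d1_def)
    then have "a * 1 \<le> a * \<bar>d1\<bar>"
      using ab by (intro mult_left_mono) auto
    moreover have "b * \<bar>d2\<bar> \<le> b * 3"
      using ab int(2)[OF vals vals, of "s 3" "s 4"] by (intro mult_left_mono) (auto simp: d2_def)
    moreover have "\<bar>a * d1\<bar> = a * \<bar>d1\<bar>" "\<bar>b * d2\<bar> = b * \<bar>d2\<bar>"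
      using ab by (simp_all add: abs_mult)
    ultimately show ?thesis
      using K' by linarith
  qed
qed

text \<open>The pivoted decompositions of the blocks turn \<open>block A B ** x = y ** h\<close> into an equation between a
diagonal matrix and \<open>h\<close> with bounded factors. Its logarithms are then within bounded distance of a
permutation of an element of \<open>log_H\<close>. The constant \<open>14400 = 120\<^sup>2\<close> consists of \<open>5!\<close> from the Leibniz
formula and of the lower bound \<open>1/120\<close> for the determinant of \<open>U\<close>; in \<open>75 = 5 \<cdot> 3 \<cdot> 5\<close> the first two
factors come from five summands with coefficients at most 3.\<close>

lemma block_double_coset_bound:
  fixes x y :: "real^5^5"
  assumes det: "det A = 1" "det B = 1" "det x = 1" and m: "max_entry A \<ge> 1" "max_entry B \<ge> 1"
    and x: "\<And>i j. \<bar>x $ i $ j\<bar> \<le> R" and y: "\<And>i j. \<bar>y $ i $ j\<bar> \<le> R"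
    and h: "h \<in> H" and eq: "block A B ** x = y ** h"
  shows "ln (max_entry B) \<le> 75 * \<bar>ln (14400 * (5 * R) ^ 5)\<bar> \<or>
    ln (max_entry A) - 3 * ln (max_entry B) \<le> 75 * \<bar>ln (14400 * (5 * R) ^ 5)\<bar>"
proof -
  obtain L1 U1 U1' a1 b1 where 1: "L1 ** A = mat2 a1 0 0 b1 ** U1" "U1 ** U1' = mat 1"
    "max_entry L1 \<le> 1" "max_entry U1 \<le> 1" "max_entry U1' \<le> 1"
    "\<bar>a1\<bar> = max_entry A" "\<bar>b1\<bar> = 1 / max_entry A"
    using pivot_decomposition[OF det(1)] by blast
  obtain L2 U2 U2' a2 b2 where 2: "L2 ** B = mat2 a2 0 0 b2 ** U2" "U2 ** U2' = mat 1"
    "max_entry L2 \<le> 1" "max_entry U2 \<le> 1" "max_entry U2' \<le> 1"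
    "\<bar>a2\<bar> = max_entry B" "\<bar>b2\<bar> = 1 / max_entry B"
    using pivot_decomposition[OF det(2)] by blast
  obtain z where z: "z \<in> log_H" "h = diagonal (\<chi> i. exp (z $ i))"
    using h by (auto simp: H_def)
  let ?L = "block L1 L2" and ?U = "block U1 U2" and ?U' = "block U1' U2'"
  let ?a = "\<chi> i. vec5 a1 b1 a2 b2 1 i"
  define s t where "s = ln (max_entry A)" and "t = ln (max_entry B)"
  let ?e = "(\<chi> i. vec5 s (- s) t (- t) 0 i) :: real^5"
  let ?K = "\<bar>ln (14400 * (5 * R) ^ 5)\<bar>"
  have "?L ** block A B = diagonal ?a ** ?U"
    by (simp add: block_mult 1 2 flip: block_diagonal)
  then have "diagonal ?a ** (?U ** x) = ?L ** (block A B ** x)"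
    by (metis matrix_mul_assoc)
  then have comparison: "diagonal ?a ** (?U ** x) = (?L ** y) ** diagonal (\<chi> i. exp (z $ i))"
    by (simp add: eq z(2) matrix_mul_assoc)
  have "?U ** ?U' = mat 1"
    by (simp add: block_mult 1 2 block_1)
  then have "det ?U * det ?U' = 1"
    by (simp flip: det_mul)
  moreover have "\<bar>det ?U'\<bar> \<le> 120"
    using det_bound[of ?U' 1] block_entry_le[OF 1(5) 2(5)] by (simp add: fact_numeral)
  moreover have "1 = \<bar>det ?U\<bar> * \<bar>det ?U'\<bar>"
    using \<open>det ?U * det ?U' = 1\<close> by (simp flip: abs_mult)
  ultimately have "1 \<le> \<bar>det ?U\<bar> * 120"
    by (metis abs_ge_zero mult_left_mono)
  then have dU: "1 / 120 \<le> \<bar>det (?U ** x)\<bar>"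
    by (simp add: det_mul det(3))
  have "\<exists>p. p permutes UNIV \<and>
    (\<forall>i. \<bar>z $ p i - ?e $ i\<bar> \<le> CARD(5) * \<bar>ln (fact CARD(5) * (5 * R) ^ CARD(5) / (1 / 120))\<bar>)"
  proof (rule diagonal_comparison[OF comparison _ _ _ dU])
    have "\<forall>i. \<bar>?a $ i\<bar> = exp (?e $ i)"
      using 1(6,7) 2(6,7) m by (simp add: forall_5 s_def t_def exp_minus inverse_eq_divide)
    then show "\<bar>?a $ i\<bar> = exp (?e $ i)" for i by blast
    show "\<bar>(?U ** x) $ i $ j\<bar> \<le> 5 * R" for i j
      using matrix_mult_entry_le[OF block_entry_le[OF 1(4) 2(4)] x, of i j] by simp
    show "\<bar>(?L ** y) $ i $ j\<bar> \<le> 5 * R" for i j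
      using matrix_mult_entry_le[OF block_entry_le[OF 1(3) 2(3)] y, of i j] by simp
    show "(\<Sum>i\<in>UNIV. ?e $ i) = 0"
      by (simp add: sum_5)
    show "(\<Sum>i\<in>UNIV. z $ i) = 0"
      using z(1) by (simp add: log_H_def)
  qed simp
  then obtain p where p: "p permutes UNIV" "\<And>i. \<bar>z $ p i - ?e $ i\<bar> \<le> 5 * ?K"
    by (auto simp: fact_numeral mult.commute)
  let ?f = "vec5 0 0 1 2 3 :: 5 \<Rightarrow> real"
  have f: "\<bar>?f i\<bar> \<le> 3" for i
    using exhaust_5[of i] by auto
  have "(\<Sum>i\<in>UNIV. ?f (p i) * z $ p i) = 0"
    using sum.permute[OF p(1), of "\<lambda>i. ?f i * z $ i"] z(1) by (simp add: log_H_def o_def)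
  then have "\<bar>\<Sum>i\<in>UNIV. ?f (p i) * ?e $ i\<bar> = \<bar>\<Sum>i\<in>UNIV. ?f (p i) * (z $ p i - ?e $ i)\<bar>"
    by (simp add: right_diff_distrib sum_subtractf)
  also have "\<dots> \<le> (\<Sum>i\<in>(UNIV::5 set). 3 * (5 * ?K))"
    using f p(2) by (intro order_trans[OF sum_abs] sum_mono) (simp only: abs_mult, intro mult_mono, auto)
  finally have "\<bar>\<Sum>i\<in>UNIV. ?f (p i) * ?e $ i\<bar> \<le> 75 * ?K"
    by simp
  then have "t \<le> 75 * ?K \<or> s - 3 * t \<le> 75 * ?K"
    using m permutes_inj[OF p(1)]
    by (intro root_form_avoids_log_H[of p]) (simp_all add: s_def t_def)
  then show ?thesis
    by (simp add: s_def t_def)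
qed

text \<open>Both alternatives in \<open>block_double_coset_bound\<close> bound the length of a reduced word for \<open>g\<close>.\<close>

lemma finite_Gamma_double_coset:
  "finite {g \<in> Gamma. \<exists>x y. (\<forall>i j. \<bar>x $ i $ j\<bar> \<le> R) \<and> (\<forall>i j. \<bar>y $ i $ j\<bar> \<le> R) \<and>
     det x = 1 \<and> (\<exists>h\<in>H. g ** x = y ** h)}" (is "finite ?S")
proof -
  let ?K = "75 * \<bar>ln (14400 * (5 * R) ^ 5)\<bar>"
  have "ln (5 / 2 :: real) > 0" by simp
  obtain N :: nat where N: "real N * ln (5 / 2) > ?K + ln 2"
    using reals_Archimedean3[OF \<open>ln (5 / 2 :: real) > 0\<close>] by blast
  have "?S \<subseteq> (\<lambda>ws. block (word 10000 ws) (word 10 ws)) ` {ws. set ws \<subseteq> UNIV \<and> length ws \<le> N}"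
  proof
    fix g assume "g \<in> ?S"
    then obtain x y h us where g: "g = block (word 10000 us) (word 10 us)" "\<And>i j. \<bar>x $ i $ j\<bar> \<le> R"
      "\<And>i j. \<bar>y $ i $ j\<bar> \<le> R" "det x = 1" "h \<in> H" "g ** x = y ** h"
      by (auto simp: Gamma_def)
    obtain ws where ws: "reduced ws" "\<And>m. m \<noteq> 0 \<Longrightarrow> word m ws = word m us"
      using reduced_word_exists[of us] by blast
    let ?A = "word 10000 ws" and ?B = "word 10 ws" and ?n = "real (length ws)"
    have gA: "g = block ?A ?B"
      using ws(2) by (simp add: g(1))
    have A: "2500 ^ length ws \<le> 2 * max_entry ?A" and B: "(5 / 2) ^ length ws \<le> 2 * max_entry ?B"
      using max_entry_reduced_word_ge[OF _ ws(1), of 10000] max_entry_reduced_word_ge[OF _ ws(1), of 10]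
      by simp_all
    have "length ws \<le> N"
    proof (rule ccontr)
      assume "\<not> length ws \<le> N"
      then have n: "N < length ws" by simp
      then have "1 \<le> length ws" by simp
      have "(5 / 2 :: real) ^ 1 \<le> (5 / 2) ^ length ws" "(2500 :: real) ^ 1 \<le> 2500 ^ length ws"
        using \<open>1 \<le> length ws\<close> by (intro power_increasing; simp)+
      then have m: "max_entry ?A \<ge> 1" "max_entry ?B \<ge> 1"
        using A B by simp_all
      have lnB: "ln (max_entry ?B) \<le> ?n * ln 10"
        using max_entry_word_le[of 10 ws] m by (simp flip: ln_realpow)
      have "ln ((5 / 2) ^ length ws) \<le> ln (2 * max_entry ?B)"
        using B m by (subst ln_le_cancel_iff) auto
      then have lnB': "?n * ln (5 / 2) \<le> ln 2 + ln (max_entry ?B)"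
        using m by (simp add: ln_realpow ln_mult)
      have "ln (2500 ^ length ws) \<le> ln (2 * max_entry ?A)"
        using A m by (subst ln_le_cancel_iff) auto
      then have "?n * ln 2500 \<le> ln 2 + ln (max_entry ?A)"
        using m by (simp add: ln_realpow ln_mult)
      moreover have "ln (2500 :: real) = 3 * ln 10 + ln (5 / 2)"
        using ln_realpow[of 10 3] ln_mult[of "10 ^ 3" "5 / 2 :: real"] by simp
      ultimately have lnA: "?n * ln (5 / 2) \<le> ln 2 + (ln (max_entry ?A) - 3 * ln (max_entry ?B))"
        using lnB by (simp add: algebra_simps)
      have "ln (max_entry ?B) \<le> ?K \<or> ln (max_entry ?A) - 3 * ln (max_entry ?B) \<le> ?K"
        using g gA m by (intro block_double_coset_bound[OF _ _ g(4) _ _ g(2,3) g(5)]) (simp_all add: det_word)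
      then have "?n * ln (5 / 2) \<le> ?K + ln 2"
        using lnA lnB' by linarith
      moreover have "real N * ln (5 / 2) \<le> ?n * ln (5 / 2)"
        using n by (intro mult_right_mono) auto
      ultimately show False
        using N by linarith
    qed
    then show "g \<in> (\<lambda>ws. block (word 10000 ws) (word 10 ws)) ` {ws. set ws \<subseteq> UNIV \<and> length ws \<le> N}"
      using gA by blast
  qed
  moreover have "finite {ws :: letter list. set ws \<subseteq> UNIV \<and> length ws \<le> N}"
    by (rule finite_lists_length_le) simp
  ultimately show ?thesis
    by (blast intro: finite_subset[OF _ finite_imageI])
qed

section \<open>Proper discontinuity\<close>

text \<open>The images of the open norm balls form an increasing open cover of the homogeneous space.\<close>

lemma compactin_homogeneous_space_bounded:
  fixes S :: "(real^'n^'n) set set"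
  assumes sub: "subgroup T SL" and S: "compactin (homogeneous_space T) S"
  shows "\<exists>R. \<forall>C\<in>S. \<exists>x\<in>carrier SL. norm x \<le> R \<and> C = translate x T"
proof -
  define U where "U n = {C. \<exists>x\<in>carrier SL. norm x < real n \<and> C = translate x T}" for n
  have TS: "T \<subseteq> carrier SL"
    using sub subgroup.subset by blast
  have "openin (homogeneous_space T) (U n)" for n
    unfolding openin_homogeneous_space
  proof
    show "U n \<subseteq> lcosets\<^bsub>SL\<^esub> T"
      by (auto simp: U_def LCOSETS_def)
    have "{x \<in> carrier SL. translate x T \<in> U n} = carrier SL \<inter> (\<Union>h\<in>T. {x. norm (x ** h) < real n})"
    proof (intro equalityI subsetI)
      fix x assume "x \<in> {x \<in> carrier SL. translate x T \<in> U n}"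
      then obtain y where y: "x \<in> carrier SL" "y \<in> carrier SL" "norm y < real n" "translate x T = translate y T"
        by (auto simp: U_def)
      have "y \<in> translate y T"
        using group.lcos_self[OF group_SL y(2) sub] .
      then obtain h where "h \<in> T" "y = x ** h"
        unfolding y(4)[symmetric] by (auto simp: l_coset_def SL_def)
      then show "x \<in> carrier SL \<inter> (\<Union>h\<in>T. {x. norm (x ** h) < real n})"
        using y by auto
    next
      fix x assume "x \<in> carrier SL \<inter> (\<Union>h\<in>T. {x. norm (x ** h) < real n})"
      then obtain h where h: "x \<in> carrier SL" "h \<in> T" "norm (x ** h) < real n"
        by auto
      have "x ** h \<in> translate x T"
        using h by (auto simp: l_coset_def SL_def)
      then have "translate x T = translate (x ** h) T"
        by (rule group.l_repr_independence[OF group_SL _ h(1) sub])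
      moreover have "x ** h \<in> carrier SL"
        using h TS by (auto simp: SL_def det_mul)
      ultimately show "x \<in> {x \<in> carrier SL. translate x T \<in> U n}"
        using h by (auto simp: U_def)
    qed
    moreover have "open (\<Union>h\<in>T. {x :: real^'n^'n. norm (x ** h) < real n})"
    proof (intro open_UN ballI)
      fix h :: "real^'n^'n"
      have "continuous_on UNIV (\<lambda>x :: real^'n^'n. x ** h)"
        by (intro bounded_bilinear.continuous_on[OF bounded_bilinear_matrix_mult]
            continuous_on_id continuous_on_const)
      then show "open {x :: real^'n^'n. norm (x ** h) < real n}"
        by (intro open_Collect_less continuous_on_norm continuous_on_const)
    qed
    ultimately show "openin SL_top {x \<in> carrier SL. translate x T \<in> U n}"
      by (simp add: openin_open_Int)
  qed
  moreover have "S \<subseteq> \<Union> (range U)"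
  proof
    fix C assume "C \<in> S"
    then have "C \<in> lcosets\<^bsub>SL\<^esub> T"
      using compactin_subset_topspace[OF S] by (auto simp: topspace_homogeneous_space)
    then obtain x where "x \<in> carrier SL" "C = translate x T"
      by (auto simp: LCOSETS_def)
    moreover obtain n where "norm x < real n"
      using reals_Archimedean2 by blast
    ultimately show "C \<in> \<Union> (range U)"
      by (auto simp: U_def)
  qed
  ultimately obtain F where F: "finite F" "F \<subseteq> range U" "S \<subseteq> \<Union> F"
    using compactinD[OF S, of "range U"] by blast
  then obtain N where N: "finite N" "F = U ` N"
    using finite_subset_image by metis
  have "\<exists>x\<in>carrier SL. norm x \<le> real (Max N) \<and> C = translate x T" if "C \<in> S" for C
  proof -
    obtain n x where "n \<in> N" "x \<in> carrier SL" "norm x < real n" "C = translate x T"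
      using F(3) N(2) \<open>C \<in> S\<close> unfolding U_def by blast
    moreover have "real n \<le> real (Max N)"
      using N(1) \<open>n \<in> N\<close> by simp
    ultimately show ?thesis
      by (intro bexI[of _ x]) auto
  qed
  then show ?thesis by blast
qed

lemma entry_le_norm: "\<bar>A $ i $ j\<bar> \<le> norm (A :: real^'n^'m)"
  using component_le_norm_cart[of "A $ i" j] Finite_Cartesian_Product.norm_nth_le[of A i] by simp

lemma Gamma_properly_discontinuous:
  "properly_discontinuous_action Gamma (homogeneous_space H) translate"
  unfolding properly_discontinuous_action_iff
proof (intro allI impI)
  fix S assume "compactin (homogeneous_space H) S"
  then obtain R where R: "\<And>C. C \<in> S \<Longrightarrow> \<exists>x\<in>carrier SL. norm x \<le> R \<and> C = translate x H"
    using compactin_homogeneous_space_bounded[OF subgroup_H] by meson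
  have HS: "H \<subseteq> carrier SL"
    using subgroup_H subgroup.subset by blast
  let ?P = "\<lambda>g. \<exists>x y. (\<forall>i j. \<bar>x $ i $ j\<bar> \<le> R) \<and> (\<forall>i j. \<bar>y $ i $ j\<bar> \<le> R) \<and>
     det x = 1 \<and> (\<exists>h\<in>H. g ** x = y ** h)"
  have "{g \<in> Gamma. translate g ` S \<inter> S \<noteq> {}} \<subseteq> {g \<in> Gamma. ?P g}"
  proof
    fix g assume "g \<in> {g \<in> Gamma. translate g ` S \<inter> S \<noteq> {}}"
    then obtain C where g: "g \<in> Gamma" and C: "C \<in> S" "translate g C \<in> S"
      by auto
    obtain x where x: "x \<in> carrier SL" "norm x \<le> R" "C = translate x H"
      using R[OF C(1)] by blast
    obtain y where y: "y \<in> carrier SL" "norm y \<le> R" "translate g C = translate y H"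
      using R[OF C(2)] by blast
    have gS: "g \<in> carrier SL"
      using g det_Gamma by (simp add: SL_def)
    have "g ** x \<in> carrier SL"
      using gS x(1) by (simp add: SL_def det_mul)
    then have "g ** x \<in> translate (g ** x) H"
      by (rule group.lcos_self[OF group_SL _ subgroup_H])
    also have "translate (g ** x) H = translate y H"
      using translate_coset[OF gS x(1) HS] x(3) y(3) by (simp add: SL_def)
    finally obtain h where "h \<in> H" "g ** x = y ** h"
      by (auto simp: l_coset_def SL_def)
    moreover have "\<forall>i j. \<bar>x $ i $ j\<bar> \<le> R" "\<forall>i j. \<bar>y $ i $ j\<bar> \<le> R"
      using x(2) y(2) entry_le_norm order_trans by blast+
    ultimately show "g \<in> {g \<in> Gamma. ?P g}"
      using g x(1) by (auto simp: SL_def)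
  qed
  then show "finite {g \<in> Gamma. translate g ` S \<inter> S \<noteq> {}}"
    by (rule finite_subset) (rule finite_Gamma_double_coset)
qed

text \<open>With \<open>x = h = 1\<close> and \<open>y = g\<close>, the finiteness of \<open>finite_Gamma_double_coset\<close> says that \<open>Gamma\<close> has
finitely many elements in each ball.\<close>

lemma discrete_Gamma: "discrete Gamma"
proof (rule discreteI)
  fix g assume g: "g \<in> Gamma"
  define R where "R = norm g + 1 + norm (mat 1 :: real^5^5)"
  have one: "mat 1 \<in> H"
    using subgroup.one_closed[OF subgroup_H] by (simp add: SL_def)
  have "Gamma \<inter> ball g 1 \<subseteq> {g \<in> Gamma. \<exists>x y. (\<forall>i j. \<bar>x $ i $ j\<bar> \<le> R) \<and> (\<forall>i j. \<bar>y $ i $ j\<bar> \<le> R) \<and>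
     det x = 1 \<and> (\<exists>h\<in>H. g ** x = y ** h)}"
  proof
    fix k assume k: "k \<in> Gamma \<inter> ball g 1"
    then have "norm k \<le> norm g + 1"
      using norm_triangle_sub[of k g] by (simp add: dist_norm norm_minus_commute)
    then have "norm k \<le> R" "norm (mat 1 :: real^5^5) \<le> R"
      unfolding R_def by (smt (verit) norm_ge_zero)+
    then have "\<forall>i j. \<bar>k $ i $ j\<bar> \<le> R" "\<forall>i j. \<bar>(mat 1 :: real^5^5) $ i $ j\<bar> \<le> R"
      using entry_le_norm order_trans by blast+
    moreover have "k ** mat 1 = k ** mat 1" ..
    moreover have "det (mat 1 :: real^5^5) = 1" by simp
    ultimately show "k \<in> {g \<in> Gamma. \<exists>x y. (\<forall>i j. \<bar>x $ i $ j\<bar> \<le> R) \<and> (\<forall>i j. \<bar>y $ i $ j\<bar> \<le> R) \<and>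
     det x = 1 \<and> (\<exists>h\<in>H. g ** x = y ** h)}"
      using k one by blast
  qed
  then have "finite (Gamma \<inter> ball g 1)"
    by (rule finite_subset) (rule finite_Gamma_double_coset)
  then have "open (ball g 1 - (Gamma \<inter> ball g 1 - {g}))"
    by (intro open_Diff finite_imp_closed) auto
  moreover have "(ball g 1 - (Gamma \<inter> ball g 1 - {g})) \<inter> Gamma = {g}"
    using g by auto
  ultimately show "g isolated_in Gamma"
    unfolding isolated_in_def using g by blast
qed

section \<open>Absence of abelian subgroups of finite index\<close>

lemma hyperbolic_powers_not_commute:
  assumes "a > 1" "b > 1"
  shows "hyperbolic False a ** hyperbolic True b \<noteq> hyperbolic True b ** hyperbolic False a"
proof
  assume "hyperbolic False a ** hyperbolic True b = hyperbolic True b ** hyperbolic False a"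
  then have "(hyperbolic False a ** hyperbolic True b) $ 1 $ 2 = (hyperbolic True b ** hyperbolic False a) $ 1 $ 2"
    by simp
  moreover define c where "c = b - 1 / b"
  ultimately have "a * (c / 2) = c / 2 * (1 / a)"
    by (simp only: hyperbolic_def if_True if_False mat2_mult mat2_nth c_def
        mult_zero_left mult_zero_right add_0_left add_0_right)
  then have "(a - 1 / a) * c = 0"
    by (simp add: algebra_simps)
  moreover have "1 / a < 1" "1 / b < 1"
    using assms by simp_all
  ultimately show False
    using assms by (auto simp: c_def)
qed

text \<open>A subgroup of finite index contains positive powers of both generators, by the pigeonhole principle
for the cosets of powers. These are hyperbolic with different axes and do not commute.\<close>

lemma Gamma_not_virtually_abelian: "\<not> virtually_abelian (SL\<lparr>carrier := Gamma\<rparr>)"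
proof
  let ?G = "SL\<lparr>carrier := Gamma\<rparr>"
  assume "virtually_abelian ?G"
  then obtain A where A: "subgroup A ?G" "comm_group (?G\<lparr>carrier := A\<rparr>)" "finite (rcosets\<^bsub>?G\<^esub> A)"
    by (auto simp: virtually_abelian_def)
  have one: "mat 1 \<in> A"
    using subgroup.one_closed[OF A(1)] by (simp add: SL_def)
  define P where "P i n = block (hyperbolic i (10000 ^ n)) (hyperbolic i (10 ^ n))" for i and n :: nat
  have P_add: "P i (m + n) = P i m ** P i n" for i m n
    by (simp add: P_def block_mult hyperbolic_mult power_add)
  have P_Gamma: "P i n \<in> Gamma" for i n
  proof -
    have "word m (replicate n (i, True)) = hyperbolic i (m ^ n)" if "m \<noteq> 0" for m
      using that by (induction n) (simp_all add: hyperbolic_1 gen_def exponent_def hyperbolic_mult)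
    then have "P i n = block (word 10000 (replicate n (i, True))) (word 10 (replicate n (i, True)))"
      by (simp add: P_def)
    then show ?thesis by (simp add: Gamma_def)
  qed
  have power_in_A: "\<exists>n>0. P i n \<in> A" for i
  proof -
    have "range (\<lambda>n. A #>\<^bsub>?G\<^esub> P i n) \<subseteq> rcosets\<^bsub>?G\<^esub> A"
      using P_Gamma by (auto simp: RCOSETS_def)
    then have "\<not> inj (\<lambda>n. A #>\<^bsub>?G\<^esub> P i n)"
      using A(3) finite_subset finite_imageD by (metis infinite_UNIV_nat)
    then obtain k l where kl: "k < l" "A #>\<^bsub>?G\<^esub> P i k = A #>\<^bsub>?G\<^esub> P i l"
      unfolding inj_def by (metis linorder_neqE_nat)
    have "mat 1 ** P i l \<in> A #>\<^bsub>?G\<^esub> P i l"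
      using one by (auto simp: r_coset_def SL_def intro!: bexI[of _ "mat 1"])
    then obtain a where a: "a \<in> A" "P i l = a ** P i k"
      unfolding kl(2)[symmetric] by (auto simp: r_coset_def SL_def)
    have "P i l = P i (l - k) ** P i k"
      using kl(1) by (simp flip: P_add)
    moreover have "invertible (P i k)"
      using det_Gamma[OF P_Gamma] by (simp add: invertible_det_nz)
    ultimately have "a = P i (l - k)"
      using a(2) unfolding invertible_def by (metis matrix_mul_assoc matrix_mul_rid)
    then show ?thesis
      using a(1) kl(1) by (intro exI[of _ "l - k"]) simp
  qed
  obtain m n where mn: "m > 0" "P False m \<in> A" "n > 0" "P True n \<in> A"
    using power_in_A by blast
  then have "P False m ** P True n = P True n ** P False m"
    using comm_groupE(4)[OF A(2)] by (simp add: SL_def)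
  then have "hyperbolic False (10 ^ m) ** hyperbolic True (10 ^ n) =
      hyperbolic True (10 ^ n) ** hyperbolic False (10 ^ m)"
    by (simp add: P_def block_mult block_eq_iff)
  then show False
    using hyperbolic_powers_not_commute[of "10 ^ m" "10 ^ n"] mn(1,3) by simp
qed

theorem theorem1p1:
  shows "\<exists>H :: (real^5^5) set. split_abelian_subgroup 3 H \<and>
    (\<exists>\<Gamma> :: (real^5^5) set. discrete_subgroup_SL \<Gamma> \<and>
        \<not> virtually_abelian (SL\<lparr>carrier := \<Gamma>\<rparr>) \<and>
        properly_discontinuous_action \<Gamma> (homogeneous_space H) translate) \<and>
    (\<forall>\<Phi> :: real^2^2 \<Rightarrow> real^5^5. lie_group_hom_SL \<Phi> \<longrightarrow>
        \<not> proper_action SL_top (homogeneous_space H) (\<lambda>g. translate (\<Phi> g)))"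
proof (intro exI conjI allI impI)
  show "split_abelian_subgroup 3 H"
    by (rule split_abelian_subgroup_H)
  show "discrete_subgroup_SL Gamma"
    by (simp add: discrete_subgroup_SL_def subgroup_Gamma discrete_Gamma)
  show "\<not> virtually_abelian (SL\<lparr>carrier := Gamma\<rparr>)"
    by (rule Gamma_not_virtually_abelian)
  show "properly_discontinuous_action Gamma (homogeneous_space H) translate"
    by (rule Gamma_properly_discontinuous)
  show "\<not> proper_action SL_top (homogeneous_space H) (\<lambda>g. translate (\<Phi> g))"
    if "lie_group_hom_SL \<Phi>" for \<Phi> :: "real^2^2 \<Rightarrow> real^5^5"
    using that by (rule SL2_action_not_proper)
qed

end
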